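(* Let $r\in\{0,1\}$ and let $M=H$ be $\mathbb S^3$ ($r=0$) or $\mathrm{AdS}_3$ ($r=1$), with principal spin bundle $P=H\times H$. Let $f\colon M\to H$ be any one of the following maps: $f^{\mathcal K^+}(q)=\mathbf 1$; $f^{\mathcal K^-}(q)=q^{-1}$; or, for a vector $Y\in\mathfrak m$ with $\|Y\|^2:=\langle Y,Y\rangle\in\{\pm1\}$, $\epsilon\in\mathcal E_r$ and $\epsilon_Y=(-1)^r\|Y\|^2\epsilon$, one of the maps $f^R_{Y,\epsilon},f^L_{Y,\epsilon}\colon M\to H$ uniquely determined by $$f^R_{Y,\epsilon}(q)\mathbb 1_\epsilon=q^{-1}\gamma(Y)q\,\mathbb 1_{\epsilon_Y},\qquad f^L_{Y,\epsilon}(q)\mathbb 1_\epsilon=\gamma(Y)q^{-1}\,\mathbb 1_{\epsilon_Y}.$$ Then $f$ determines an $\Omega$-Lagrangian section of $P$, namely $$s_f(q)=\bigl(qf(q),(f(q)^{-1})^\dagger\bigr),\qquad s_f^*\Omega=0.$$ In particular, when $c=\sqrt3$, these sections are Lagrangian sections of the nearly pseudo-Kähler structure $(\mathcal G_c,\mathcal J_c)$ on $P$.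
   Context: Algebra. $\mathfrak m=(\mathbb R^{r,3-r},\langle\cdot,\cdot\rangle)$ is oriented with oriented orthonormal basis $X_0,X_1,X_2$, $\langle X_0,X_0\rangle=(-1)^r$, $\langle X_1,X_1\rangle=\langle X_2,X_2\rangle=1$. $H=\mathrm{SU}(2)$ if $r=0$, $H=\mathrm{SU}(1,1)$ if $r=1$, with Lie algebra $\mathfrak h$. Put $\gamma_1=\begin{pmatrix}0&1\\-1&0\end{pmatrix}$, $\gamma_2=\begin{pmatrix}0&\sqrt{-1}\\ \sqrt{-1}&0\end{pmatrix}$, and $\gamma_0=\mathrm{diag}(\sqrt{-1},-\sqrt{-1})$ if $r=0$, $\gamma_0=\mathrm{diag}(1,-1)$ if $r=1$; $\gamma\colon\mathfrak m\to\mathfrak{gl}(2,\mathbb C)$ is linear with $\gamma(X_k)=\gamma_k$. $l_g\colon\mathfrak m\to\mathfrak h$ is the linear isomorphism $l_g(X)=\frac{(\sqrt{-1})^r}{2}\gamma(X)$. $\mathcal E_0=\{+1\}$, $\mathcal E_1=\{+1,-1\}$; $\mathbb 1_{+1}=(1,0)^T$, $\mathbb 1_{-1}=(0,1)^T$. Space. $M=H$ carries the bi-invariant metric $g$ of constant sectional curvature $(-1)^r$: $g_q(2q\,l_g(X),2q\,l_g(Y))=\langle X,Y\rangle$. Its principal spin bundle is $P=H\times H$ with $\pi(g_L,g_R)=g_Lg_R^\dagger$, right $H$-action $(g_L,g_R)\cdot h=(g_Lh,g_R(h^{-1})^\dagger)$, solder form $\theta=l_g^{-1}\frac{\omega^L+(\omega^R)^\dagger}{2}$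 and spin Levi-Civita connection form $\widetilde\omega=\frac{\omega^L-(\omega^R)^\dagger}{2}$, where $\omega^L,\omega^R$ are the (left-invariant) Maurer–Cartan forms of the factors. Structure on $P$. For $X\in\mathfrak m$, $X^H$ is the vector field on $P$ with $\theta(X^H)=X$, $\widetilde\omega(X^H)=0$; for $U\in\mathfrak h$, $U^\#$ is the fundamental vector field ($\widetilde\omega(U^\#)=U$, $\theta(U^\#)=0$). For $c>0$: $\mathcal J_c(X^H+U^\#)=-c^{-1}(l_g^{-1}U)^H+c(l_gX)^\#$, $\mathcal G_c(X^H+U^\#,Y^H+V^\#)=c\langle X,Y\rangle+c^{-1}\langle l_g^{-1}U,l_g^{-1}V\rangle$; $\Omega=\mathcal G_c(\mathcal J_c\cdot,\cdot)$, i.e. $\Omega(X^H+U^\#,Y^H+V^\#)=\langle X,l_g^{-1}V\rangle-\langle l_g^{-1}U,Y\rangle$ (independent of $c$). A section $s$ is $\Omega$-Lagrangian (equivalently Lagrangian for $(\mathcal G_c,\mathcal J_c)$) if $s^*\Omega=0$. An almost pseudo-Hermitian structure $(h,\mathcal J)$ is nearly pseudo-Kähler if $(\nabla_{\mathcal X}\mathcal J)\mathcal X=0$ for all vector fields $\mathcal X$, $\nabla$ the Levi-Civita connection of $h$. *)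

theory Defs
  imports "HOL-Analysis.Analysis"
begin

section \<open>Calculus on embedded submanifolds of a Euclidean space\<close>

text \<open>
  Manifolds are given as subsets \<open>S\<close> of a Euclidean space; the definitions below are meant for
  embedded submanifolds. The differential of a smooth map \<open>f\<close> at \<open>p \<in> S\<close> is
  \<open>frechet_derivative f (at p within S)\<close>. It depends only on the values of \<open>f\<close> on \<open>S\<close>,
  and it is uniquely determined on the tangent space at \<open>p\<close>, the only place where it is used.
\<close>

fun Ck_on :: "nat \<Rightarrow> 'a::euclidean_space set \<Rightarrow> ('a \<Rightarrow> 'b::euclidean_space) \<Rightarrow> bool" where
  "Ck_on 0 U f \<longleftrightarrow> continuous_on U f"
| "Ck_on (Suc k) U f \<longleftrightarrow>
     (\<forall>x\<in>U. f differentiable at x) \<and> (\<forall>v. Ck_on k U (\<lambda>x. frechet_derivative f (at x) v))"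

definition smooth_map :: "'a::euclidean_space set \<Rightarrow> ('a \<Rightarrow> 'b::euclidean_space) \<Rightarrow> bool" where
  "smooth_map S f \<longleftrightarrow>
     (\<forall>p\<in>S. \<exists>U F. open U \<and> p \<in> U \<and> (\<forall>k. Ck_on k U F) \<and> (\<forall>x\<in>S \<inter> U. F x = f x))"

definition tangent_space :: "'a::euclidean_space set \<Rightarrow> 'a \<Rightarrow> 'a set" where
  "tangent_space S p =
     {v. \<exists>\<sigma>::real \<Rightarrow> 'a. (\<forall>t. \<sigma> t \<in> S) \<and> \<sigma> 0 = p \<and> (\<sigma> has_vector_derivative v) (at 0)}"

definition vector_field :: "'a::euclidean_space set \<Rightarrow> ('a \<Rightarrow> 'a) \<Rightarrow> bool" where
  "vector_field S X \<longleftrightarrow> smooth_map S X \<and> (\<forall>p\<in>S. X p \<in> tangent_space S p)"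

definition dir_deriv ::
    "'a::euclidean_space set \<Rightarrow> ('a \<Rightarrow> 'a) \<Rightarrow> ('a \<Rightarrow> 'b::euclidean_space) \<Rightarrow> 'a \<Rightarrow> 'b" where
  "dir_deriv S X f p = frechet_derivative f (at p within S) (X p)"

definition lie_bracket ::
    "'a::euclidean_space set \<Rightarrow> ('a \<Rightarrow> 'a) \<Rightarrow> ('a \<Rightarrow> 'a) \<Rightarrow> 'a \<Rightarrow> 'a" where
  "lie_bracket S X Y p = dir_deriv S X Y p - dir_deriv S Y X p"

definition pullback2 ::
    "'a::euclidean_space set \<Rightarrow> ('a \<Rightarrow> 'b::euclidean_space) \<Rightarrow> ('b \<Rightarrow> 'b \<Rightarrow> 'b \<Rightarrow> real)
      \<Rightarrow> 'a \<Rightarrow> 'a \<Rightarrow> 'a \<Rightarrow> real" where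
  "pullback2 S s \<omega> p v w =
     \<omega> (s p) (frechet_derivative s (at p within S) v) (frechet_derivative s (at p within S) w)"

definition pseudo_metric ::
    "'a::euclidean_space set \<Rightarrow> ('a \<Rightarrow> 'a \<Rightarrow> 'a \<Rightarrow> real) \<Rightarrow> bool" where
  "pseudo_metric S h \<longleftrightarrow>
     (\<forall>p\<in>S. \<forall>u\<in>tangent_space S p. \<forall>v\<in>tangent_space S p. \<forall>w\<in>tangent_space S p. \<forall>a.
        h p (a *\<^sub>R u + v) w = a * h p u w + h p v w) \<and>
     (\<forall>p\<in>S. \<forall>v\<in>tangent_space S p. \<forall>w\<in>tangent_space S p. h p v w = h p w v) \<and>
     (\<forall>p\<in>S. \<forall>v\<in>tangent_space S p. (\<forall>w\<in>tangent_space S p. h p v w = 0) \<longrightarrow> v = 0) \<and>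
     (\<forall>X Y. vector_field S X \<longrightarrow> vector_field S Y \<longrightarrow> smooth_map S (\<lambda>p. h p (X p) (Y p)))"

definition connection ::
    "'a::euclidean_space set \<Rightarrow> (('a \<Rightarrow> 'a) \<Rightarrow> ('a \<Rightarrow> 'a) \<Rightarrow> 'a \<Rightarrow> 'a) \<Rightarrow> bool" where
  "connection S D \<longleftrightarrow>
     (\<forall>X Y. vector_field S X \<longrightarrow> vector_field S Y \<longrightarrow> vector_field S (D X Y)) \<and>
     (\<forall>X X' Y. vector_field S X \<longrightarrow> vector_field S X' \<longrightarrow> vector_field S Y \<longrightarrow>
        (\<forall>p\<in>S. D (\<lambda>x. X x + X' x) Y p = D X Y p + D X' Y p)) \<and>
     (\<forall>\<phi>::'a \<Rightarrow> real. \<forall>X Y. smooth_map S \<phi> \<longrightarrow> vector_field S X \<longrightarrow> vector_field S Y \<longrightarrow>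
        (\<forall>p\<in>S. D (\<lambda>x. \<phi> x *\<^sub>R X x) Y p = \<phi> p *\<^sub>R D X Y p)) \<and>
     (\<forall>X Y Y'. vector_field S X \<longrightarrow> vector_field S Y \<longrightarrow> vector_field S Y' \<longrightarrow>
        (\<forall>p\<in>S. D X (\<lambda>x. Y x + Y' x) p = D X Y p + D X Y' p)) \<and>
     (\<forall>\<phi>::'a \<Rightarrow> real. \<forall>X Y. smooth_map S \<phi> \<longrightarrow> vector_field S X \<longrightarrow> vector_field S Y \<longrightarrow>
        (\<forall>p\<in>S. D X (\<lambda>x. \<phi> x *\<^sub>R Y x) p = dir_deriv S X \<phi> p *\<^sub>R Y p + \<phi> p *\<^sub>R D X Y p))"

text \<open>The Levi-Civita connection: torsion-free and metric, hence unique (on \<open>S\<close>).\<close>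

definition levi_civita ::
    "'a::euclidean_space set \<Rightarrow> ('a \<Rightarrow> 'a \<Rightarrow> 'a \<Rightarrow> real)
      \<Rightarrow> (('a \<Rightarrow> 'a) \<Rightarrow> ('a \<Rightarrow> 'a) \<Rightarrow> 'a \<Rightarrow> 'a) \<Rightarrow> bool" where
  "levi_civita S h D \<longleftrightarrow> connection S D \<and>
     (\<forall>X Y. vector_field S X \<longrightarrow> vector_field S Y \<longrightarrow>
        (\<forall>p\<in>S. D X Y p - D Y X p = lie_bracket S X Y p)) \<and>
     (\<forall>X Y Z. vector_field S X \<longrightarrow> vector_field S Y \<longrightarrow> vector_field S Z \<longrightarrow>
        (\<forall>p\<in>S. dir_deriv S X (\<lambda>x. h x (Y x) (Z x)) p
           = h p (D X Y p) (Z p) + h p (Y p) (D X Z p)))"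

definition almost_pseudo_hermitian ::
    "'a::euclidean_space set \<Rightarrow> ('a \<Rightarrow> 'a \<Rightarrow> 'a \<Rightarrow> real) \<Rightarrow> ('a \<Rightarrow> 'a \<Rightarrow> 'a) \<Rightarrow> bool" where
  "almost_pseudo_hermitian S h J \<longleftrightarrow> pseudo_metric S h \<and>
     (\<forall>p\<in>S. \<forall>v\<in>tangent_space S p. \<forall>w\<in>tangent_space S p. \<forall>a.
        J p (a *\<^sub>R v + w) = a *\<^sub>R J p v + J p w) \<and>
     (\<forall>p\<in>S. \<forall>v\<in>tangent_space S p. J p v \<in> tangent_space S p \<and> J p (J p v) = - v) \<and>
     (\<forall>X. vector_field S X \<longrightarrow> vector_field S (\<lambda>p. J p (X p))) \<and>
     (\<forall>p\<in>S. \<forall>v\<in>tangent_space S p. \<forall>w\<in>tangent_space S p. h p (J p v) (J p w) = h p v w)"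

text \<open>The condition \<open>(\<nabla>\<^sub>X J) X = 0\<close> reads \<open>\<nabla>\<^sub>X (J X) = J (\<nabla>\<^sub>X X)\<close>.\<close>

definition nearly_pseudo_kaehler ::
    "'a::euclidean_space set \<Rightarrow> ('a \<Rightarrow> 'a \<Rightarrow> 'a \<Rightarrow> real) \<Rightarrow> ('a \<Rightarrow> 'a \<Rightarrow> 'a) \<Rightarrow> bool" where
  "nearly_pseudo_kaehler S h J \<longleftrightarrow> almost_pseudo_hermitian S h J \<and>
     (\<exists>D. levi_civita S h D \<and>
        (\<forall>X. vector_field S X \<longrightarrow> (\<forall>p\<in>S. D X (\<lambda>x. J x (X x)) p - J p (D X X p) = 0)))"


section \<open>The algebraic data\<close>

type_synonym cmat = "complex^2^2"

definition dagger :: "cmat \<Rightarrow> cmat" where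
  "dagger A = (\<chi> i j. cnj (A $ j $ i))"

text \<open>\<open>SU(2)\<close> for \<open>r = 0\<close> and \<open>SU(1,1)\<close> for \<open>r = 1\<close>.\<close>

definition herm_form :: "nat \<Rightarrow> cmat" where
  "herm_form r = vector [vector [1, 0], vector [0, (-1) ^ r]]"

definition Hgrp :: "nat \<Rightarrow> cmat set" where
  "Hgrp r = {A. dagger A ** herm_form r ** A = herm_form r \<and> det A = 1}"

text \<open>
  \<open>\<real>\<^bsup>r,3-r\<^esup>\<close> is the type \<open>real^3\<close>: the vector \<open>Y\<close> has the coordinates \<open>Y $ 0\<close>, \<open>Y $ 1\<close>, \<open>Y $ 2\<close>
  with respect to the basis \<open>X\<^sub>0, X\<^sub>1, X\<^sub>2\<close>. (In the index type \<open>3\<close> the numeral 3 equals 0.)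
\<close>

definition ip :: "nat \<Rightarrow> real^3 \<Rightarrow> real^3 \<Rightarrow> real" where
  "ip r X Y = (-1) ^ r * X $ 0 * Y $ 0 + X $ 1 * Y $ 1 + X $ 2 * Y $ 2"

definition gamma0 :: "nat \<Rightarrow> cmat" where
  "gamma0 r = (if r = 0 then vector [vector [\<i>, 0], vector [0, - \<i>]]
                         else vector [vector [1, 0], vector [0, - 1]])"

definition gamma1 :: cmat where
  "gamma1 = vector [vector [0, 1], vector [- 1, 0]]"

definition gamma2 :: cmat where
  "gamma2 = vector [vector [0, \<i>], vector [\<i>, 0]]"

definition gam :: "nat \<Rightarrow> real^3 \<Rightarrow> cmat" where
  "gam r X = (X $ 0) *\<^sub>R gamma0 r + (X $ 1) *\<^sub>R gamma1 + (X $ 2) *\<^sub>R gamma2"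

text \<open>
  \<open>lg r\<close> is injective with image the Lie algebra \<open>tangent_space (Hgrp r) (mat 1)\<close>;
  \<open>inv (lg r)\<close> is only applied to elements of the latter.
\<close>

definition lg :: "nat \<Rightarrow> real^3 \<Rightarrow> cmat" where
  "lg r X = mat (\<i> ^ r / 2) ** gam r X"

definition signs :: "nat \<Rightarrow> real set" where
  "signs r = (if r = 0 then {1} else {1, - 1})"

definition spinor :: "real \<Rightarrow> complex^2" where
  "spinor \<epsilon> = (if \<epsilon> = 1 then vector [1, 0] else vector [0, 1])"


section \<open>The principal spin bundle and its structures\<close>

definition spin_bundle :: "nat \<Rightarrow> (cmat \<times> cmat) set" where
  "spin_bundle r = Hgrp r \<times> Hgrp r"

definition bundle_proj :: "cmat \<times> cmat \<Rightarrow> cmat" where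
  "bundle_proj p = fst p ** dagger (snd p)"

definition right_action :: "cmat \<times> cmat \<Rightarrow> cmat \<Rightarrow> cmat \<times> cmat" where
  "right_action p h = (fst p ** h, snd p ** dagger (matrix_inv h))"

definition omegaL :: "cmat \<times> cmat \<Rightarrow> cmat \<times> cmat \<Rightarrow> cmat" where
  "omegaL p v = matrix_inv (fst p) ** fst v"

definition omegaR :: "cmat \<times> cmat \<Rightarrow> cmat \<times> cmat \<Rightarrow> cmat" where
  "omegaR p v = matrix_inv (snd p) ** snd v"

definition solder_form :: "nat \<Rightarrow> cmat \<times> cmat \<Rightarrow> cmat \<times> cmat \<Rightarrow> real^3" where
  "solder_form r p v = inv (lg r) ((1/2) *\<^sub>R (omegaL p v + dagger (omegaR p v)))"

definition connection_form :: "cmat \<times> cmat \<Rightarrow> cmat \<times> cmat \<Rightarrow> cmat" where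
  "connection_form p v = (1/2) *\<^sub>R (omegaL p v - dagger (omegaR p v))"

text \<open>The vector fields \<open>X\<^sup>H\<close> and \<open>U\<^sup>#\<close>, the latter as the differential of \<open>h \<mapsto> p \<cdot> h\<close> at \<open>1\<close>.\<close>

definition horizontal :: "nat \<Rightarrow> real^3 \<Rightarrow> cmat \<times> cmat \<Rightarrow> cmat \<times> cmat" where
  "horizontal r X p = (THE v. v \<in> tangent_space (spin_bundle r) p \<and>
     solder_form r p v = X \<and> connection_form p v = 0)"

definition fundamental :: "nat \<Rightarrow> cmat \<Rightarrow> cmat \<times> cmat \<Rightarrow> cmat \<times> cmat" where
  "fundamental r U p = frechet_derivative (right_action p) (at (mat 1) within Hgrp r) U"

text \<open>A tangent vector \<open>v = X\<^sup>H + U\<^sup>#\<close> has \<open>X = solder_form r p v\<close> and \<open>U = connection_form p v\<close>.\<close>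

definition Jc :: "nat \<Rightarrow> real \<Rightarrow> cmat \<times> cmat \<Rightarrow> cmat \<times> cmat \<Rightarrow> cmat \<times> cmat" where
  "Jc r c p v = horizontal r (- (1/c) *\<^sub>R inv (lg r) (connection_form p v)) p
              + fundamental r (c *\<^sub>R lg r (solder_form r p v)) p"

definition Gc :: "nat \<Rightarrow> real \<Rightarrow> cmat \<times> cmat \<Rightarrow> cmat \<times> cmat \<Rightarrow> cmat \<times> cmat \<Rightarrow> real" where
  "Gc r c p v w = c * ip r (solder_form r p v) (solder_form r p w)
     + (1/c) * ip r (inv (lg r) (connection_form p v)) (inv (lg r) (connection_form p w))"

definition Omega :: "nat \<Rightarrow> cmat \<times> cmat \<Rightarrow> cmat \<times> cmat \<Rightarrow> cmat \<times> cmat \<Rightarrow> real" where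
  "Omega r p v w = ip r (solder_form r p v) (inv (lg r) (connection_form p w))
                 - ip r (inv (lg r) (connection_form p v)) (solder_form r p w)"

definition bundle_section :: "nat \<Rightarrow> (cmat \<Rightarrow> cmat \<times> cmat) \<Rightarrow> bool" where
  "bundle_section r s \<longleftrightarrow> smooth_map (Hgrp r) s \<and> (\<forall>q\<in>Hgrp r. s q \<in> spin_bundle r \<and> bundle_proj (s q) = q)"

definition lagrangian_section ::
    "nat \<Rightarrow> (cmat \<times> cmat \<Rightarrow> cmat \<times> cmat \<Rightarrow> cmat \<times> cmat \<Rightarrow> real)
      \<Rightarrow> (cmat \<Rightarrow> cmat \<times> cmat) \<Rightarrow> bool" where
  "lagrangian_section r \<omega> s \<longleftrightarrow> bundle_section r s \<and>
     (\<forall>q\<in>Hgrp r. \<forall>v\<in>tangent_space (Hgrp r) q. \<forall>w\<in>tangent_space (Hgrp r) q.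
        pullback2 (Hgrp r) s \<omega> q v w = 0)"


section \<open>The maps and their sections\<close>

definition fKplus :: "cmat \<Rightarrow> cmat" where
  "fKplus q = mat 1"

definition fKminus :: "cmat \<Rightarrow> cmat" where
  "fKminus q = matrix_inv q"

definition eps :: "nat \<Rightarrow> real^3 \<Rightarrow> real \<Rightarrow> real" where
  "eps r Y \<epsilon> = (-1) ^ r * ip r Y Y * \<epsilon>"

definition fR_eq :: "nat \<Rightarrow> real^3 \<Rightarrow> real \<Rightarrow> cmat \<Rightarrow> cmat \<Rightarrow> bool" where
  "fR_eq r Y \<epsilon> q h \<longleftrightarrow>
     h *v spinor \<epsilon> = (matrix_inv q ** gam r Y ** q) *v spinor (eps r Y \<epsilon>)"

definition fL_eq :: "nat \<Rightarrow> real^3 \<Rightarrow> real \<Rightarrow> cmat \<Rightarrow> cmat \<Rightarrow> bool" where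
  "fL_eq r Y \<epsilon> q h \<longleftrightarrow>
     h *v spinor \<epsilon> = (gam r Y ** matrix_inv q) *v spinor (eps r Y \<epsilon>)"

definition fR :: "nat \<Rightarrow> real^3 \<Rightarrow> real \<Rightarrow> cmat \<Rightarrow> cmat" where
  "fR r Y \<epsilon> q = (THE h. h \<in> Hgrp r \<and> fR_eq r Y \<epsilon> q h)"

definition fL :: "nat \<Rightarrow> real^3 \<Rightarrow> real \<Rightarrow> cmat \<Rightarrow> cmat" where
  "fL r Y \<epsilon> q = (THE h. h \<in> Hgrp r \<and> fL_eq r Y \<epsilon> q h)"

definition spin_section :: "(cmat \<Rightarrow> cmat) \<Rightarrow> cmat \<Rightarrow> cmat \<times> cmat" where
  "spin_section f q = (q ** f q, dagger (matrix_inv (f q)))"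

end

theory Submission
  imports Defs
begin

text \<open>
  The bundle \<open>P = H \<times> H\<close> is parallelized by the left-invariant fields \<open>X\<^sup>H + U\<^sup>#\<close>, in which the metric
  and the almost complex structure are constant and the Lie bracket is given by a cross product. The
  Levi-Civita connection is then a directional derivative of components plus a constant bilinear map,
  and the nearly Kaehler condition becomes an identity between cross products.

  On \<open>H\<close> the inverse is the adjugate, so each \<open>f\<close> is the restriction of a polynomial map; multiplying the
  spinor equations by \<open>\<i>\<^sup>r\<close> and absorbing the change of spinor into a constant matrix \<open>K\<close> gives
  \<open>f(q) = q\<^sup>-\<^sup>1 g q K\<close> or \<open>f(q) = g q\<^sup>-\<^sup>1 K\<close> with \<open>g\<close> a multiple of \<open>lg r Y\<close>. A section \<open>s\<^sub>f\<close> is Lagrangian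
  iff \<open>V \<mapsto> df(q V) f(q)\<^sup>-\<^sup>1\<close> is self-adjoint for the trace form. For these \<open>f\<close> the map is a
  combination of the identity and of \<open>V \<mapsto> k V k\<close> with \<open>k\<close> in the Lie algebra.
\<close>

section \<open>Smooth maps on subsets of a Euclidean space\<close>

text \<open>Openness makes the derivative at a point of \<open>U\<close> depend on the values in
  \<open>U\<close> only, so the agreement of \<open>f\<close> and \<open>g\<close> passes to their
  derivatives and the recursion on \<open>k\<close> goes through.\<close>

lemma Ck_on_cong:
  assumes "open U" "\<And>x. x \<in> U \<Longrightarrow> f x = g x" "Ck_on k U f"
  shows "Ck_on k U g"
  using assms(2,3)
proof (induction k arbitrary: f g)
  case 0
  then show ?case by (simp cong: continuous_on_cong)
next
  case (Suc k)
  have d: "(g has_derivative frechet_derivative f (at x)) (at x)" if "x \<in> U" for x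
    using Suc.prems that \<open>open U\<close>
    by (intro has_derivative_transform_within_open[of f _ x UNIV U g])
       (auto simp: frechet_derivative_works)
  have "Ck_on k U (\<lambda>x. frechet_derivative g (at x) v)" for v
  proof (rule Suc.IH)
    show "Ck_on k U (\<lambda>x. frechet_derivative f (at x) v)" using Suc.prems by simp
  qed (metis d frechet_derivative_at)
  then show ?case using d by (auto intro: differentiableI)
qed

lemma Ck_on_subset: "Ck_on k U f \<Longrightarrow> V \<subseteq> U \<Longrightarrow> Ck_on k V f"
  by (induction k arbitrary: f) (auto intro: continuous_on_subset)

lemma Ck_on_SucD: "Ck_on (Suc k) U f \<Longrightarrow> Ck_on k U f"
proof (induction k arbitrary: f)
  case 0
  then show ?case
    by (auto intro!: continuous_at_imp_continuous_on differentiable_imp_continuous_within)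
next
  case (Suc k)
  have "Ck_on k U (\<lambda>x. frechet_derivative f (at x) v)" for v
    using Suc.prems by (intro Suc.IH) simp
  then show ?case using Suc.prems by simp
qed

lemma Ck_on_SucI:
  assumes "open U" "\<And>x. x \<in> U \<Longrightarrow> (f has_derivative f' x) (at x)"
    "\<And>v. Ck_on k U (\<lambda>x. f' x v)"
  shows "Ck_on (Suc k) U f"
proof -
  have "Ck_on k U (\<lambda>x. frechet_derivative f (at x) v)" for v
    by (rule Ck_on_cong[OF assms(1) _ assms(3)[of v]]) (metis assms(2) frechet_derivative_at)
  then show ?thesis using assms(2) by (auto intro: differentiableI)
qed

section \<open>Closure of the classes C^k under linear and bilinear operations\<close>

lemma Ck_on_SucE:
  assumes "Ck_on (Suc k) U f" "x \<in> U"
  shows "(f has_derivative frechet_derivative f (at x)) (at x)"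
  using assms by (simp add: frechet_derivative_works)

lemma Ck_on_const:
  assumes "open U"
  shows "Ck_on k U (\<lambda>x. c)"
proof (induction k arbitrary: c)
  case (Suc k)
  show ?case by (rule Ck_on_SucI[OF assms has_derivative_const Suc.IH])
qed simp

lemma Ck_on_ident:
  assumes "open U"
  shows "Ck_on k U (\<lambda>x. x)"
proof (cases k)
  case (Suc k)
  show ?thesis unfolding Suc
    by (rule Ck_on_SucI[OF assms has_derivative_ident Ck_on_const[OF assms]])
qed simp

lemma Ck_on_linear:
  assumes "bounded_linear L" "open U" "Ck_on k U g"
  shows "Ck_on k U (\<lambda>x. L (g x))"
  using assms(3)
proof (induction k arbitrary: g)
  case 0
  then show ?case using bounded_linear.continuous_on[OF assms(1)] by simp
next
  case (Suc k)
  show ?case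
  proof (rule Ck_on_SucI[OF assms(2)])
    show "((\<lambda>x. L (g x)) has_derivative (\<lambda>v. L (frechet_derivative g (at x) v))) (at x)" if "x \<in> U" for x
      using bounded_linear.has_derivative[OF assms(1) Ck_on_SucE[OF Suc.prems that]] .
    show "Ck_on k U (\<lambda>x. L (frechet_derivative g (at x) v))" for v
      using Suc.prems by (intro Suc.IH) simp
  qed
qed

lemma Ck_on_add:
  assumes "open U" "Ck_on k U f" "Ck_on k U g"
  shows "Ck_on k U (\<lambda>x. f x + g x)"
  using assms(2,3)
proof (induction k arbitrary: f g)
  case 0
  then show ?case by (simp add: continuous_on_add)
next
  case (Suc k)
  show ?case
  proof (rule Ck_on_SucI[OF assms(1)])
    show "((\<lambda>x. f x + g x) has_derivative
        (\<lambda>v. frechet_derivative f (at x) v + frechet_derivative g (at x) v)) (at x)" if "x \<in> U" for x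
      using Ck_on_SucE[OF Suc.prems(1) that] Ck_on_SucE[OF Suc.prems(2) that]
      by (rule has_derivative_add)
    show "Ck_on k U (\<lambda>x. frechet_derivative f (at x) v + frechet_derivative g (at x) v)" for v
      using Suc.prems by (intro Suc.IH) auto
  qed
qed

lemma Ck_on_sum:
  assumes "open U" "\<And>i. i \<in> I \<Longrightarrow> Ck_on k U (f i)"
  shows "Ck_on k U (\<lambda>x. \<Sum>i\<in>I. f i x)"
  using assms(2)
  by (induction I rule: infinite_finite_induct) (simp_all add: Ck_on_const Ck_on_add assms(1))

lemma Ck_on_bilinear:
  assumes "bounded_bilinear b" "open U" "Ck_on k U f" "Ck_on k U g"
  shows "Ck_on k U (\<lambda>x. b (f x) (g x))"
  using assms(3,4)
proof (induction k arbitrary: f g)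
  case 0
  then show ?case using bounded_bilinear.continuous_on[OF assms(1)] by simp
next
  case (Suc k)
  show ?case
  proof (rule Ck_on_SucI[OF assms(2)])
    show "((\<lambda>x. b (f x) (g x)) has_derivative
        (\<lambda>v. b (f x) (frechet_derivative g (at x) v) + b (frechet_derivative f (at x) v) (g x))) (at x)"
      if "x \<in> U" for x
      using bounded_bilinear.FDERIV[OF assms(1) Ck_on_SucE[OF Suc.prems(1) that] Ck_on_SucE[OF Suc.prems(2) that]] .
    \<comment> \<open>The product rule leaves one factor undifferentiated, so \<open>f\<close> and
      \<open>g\<close> themselves are needed at order \<open>k\<close>; \<open>Ck_on_SucD\<close>
      supplies this.\<close>
    show "Ck_on k U (\<lambda>x. b (f x) (frechet_derivative g (at x) v) + b (frechet_derivative f (at x) v) (g x))" for v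
      using Suc.prems Ck_on_SucD[OF Suc.prems(1)] Ck_on_SucD[OF Suc.prems(2)]
      by (intro Ck_on_add assms(2) Suc.IH) simp_all
  qed
qed

section \<open>Smooth maps on a subset through local extensions\<close>

lemma smooth_mapE:
  assumes "smooth_map S f" "p \<in> S"
  obtains U F where "open U" "p \<in> U" "\<And>k. Ck_on k U F" "\<And>x. x \<in> S \<Longrightarrow> x \<in> U \<Longrightarrow> F x = f x"
proof -
  have "\<exists>U F. open U \<and> p \<in> U \<and> (\<forall>k. Ck_on k U F) \<and> (\<forall>x\<in>S \<inter> U. F x = f x)"
    using assms unfolding smooth_map_def by (rule bspec)
  then obtain U F where "open U" "p \<in> U" "\<forall>k. Ck_on k U F" "\<forall>x\<in>S \<inter> U. F x = f x"
    by (elim exE conjE)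
  then show thesis by (intro that[of U F]) simp_all
qed

lemma smooth_mapE2:
  assumes "smooth_map S f" "smooth_map S g" "p \<in> S"
  obtains U F G where "open U" "p \<in> U" "\<And>k. Ck_on k U F" "\<And>x. x \<in> S \<Longrightarrow> x \<in> U \<Longrightarrow> F x = f x"
    "\<And>k. Ck_on k U G" "\<And>x. x \<in> S \<Longrightarrow> x \<in> U \<Longrightarrow> G x = g x"
proof -
  obtain U F where U: "open U" "p \<in> U" "\<And>k. Ck_on k U F" "\<And>x. x \<in> S \<Longrightarrow> x \<in> U \<Longrightarrow> F x = f x"
    using smooth_mapE[OF assms(1,3)] by blast
  obtain V G where V: "open V" "p \<in> V" "\<And>k. Ck_on k V G" "\<And>x. x \<in> S \<Longrightarrow> x \<in> V \<Longrightarrow> G x = g x"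
    using smooth_mapE[OF assms(2,3)] by blast
  show thesis
    by (rule that[of "U \<inter> V" F G]) (use U V in \<open>auto intro: Ck_on_subset\<close>)
qed

lemma smooth_map_cong:
  assumes "\<And>x. x \<in> S \<Longrightarrow> f x = g x"
  shows "smooth_map S f \<longleftrightarrow> smooth_map S g"
  using assms unfolding smooth_map_def by (metis IntD1)

lemma smooth_map_const: "smooth_map S (\<lambda>x. c)"
  unfolding smooth_map_def by (metis Ck_on_const UNIV_I open_UNIV)

lemma smooth_map_ident: "smooth_map S (\<lambda>x. x)"
  unfolding smooth_map_def by (metis Ck_on_ident UNIV_I open_UNIV)

lemma smooth_map_linear:
  assumes "bounded_linear L" "smooth_map S g"
  shows "smooth_map S (\<lambda>x. L (g x))"
  unfolding smooth_map_def
proof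
  fix p assume "p \<in> S"
  then obtain U F where "open U" "p \<in> U" "\<And>k. Ck_on k U F" "\<And>x. x \<in> S \<Longrightarrow> x \<in> U \<Longrightarrow> F x = g x"
    using smooth_mapE[OF assms(2)] by blast
  then show "\<exists>U F. open U \<and> p \<in> U \<and> (\<forall>k. Ck_on k U F) \<and> (\<forall>x\<in>S \<inter> U. F x = L (g x))"
    by (intro exI[of _ U] exI[of _ "\<lambda>x. L (F x)"]) (auto intro: Ck_on_linear[OF assms(1)])
qed

lemma smooth_map_bilinear:
  assumes "bounded_bilinear b" "smooth_map S f" "smooth_map S g"
  shows "smooth_map S (\<lambda>x. b (f x) (g x))"
  unfolding smooth_map_def
proof
  fix p assume "p \<in> S"
  then obtain U F G where "open U" "p \<in> U" "\<And>k. Ck_on k U F" "\<And>x. x \<in> S \<Longrightarrow> x \<in> U \<Longrightarrow> F x = f x"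
    "\<And>k. Ck_on k U G" "\<And>x. x \<in> S \<Longrightarrow> x \<in> U \<Longrightarrow> G x = g x"
    using smooth_mapE2[OF assms(2,3)] by blast
  then show "\<exists>U F. open U \<and> p \<in> U \<and> (\<forall>k. Ck_on k U F) \<and> (\<forall>x\<in>S \<inter> U. F x = b (f x) (g x))"
    by (intro exI[of _ U] exI[of _ "\<lambda>x. b (F x) (G x)"]) (auto intro: Ck_on_bilinear[OF assms(1)])
qed

lemma smooth_map_add:
  assumes "smooth_map S f" "smooth_map S g"
  shows "smooth_map S (\<lambda>x. f x + g x)"
  unfolding smooth_map_def
proof
  fix p assume "p \<in> S"
  then obtain U F G where "open U" "p \<in> U" "\<And>k. Ck_on k U F" "\<And>x. x \<in> S \<Longrightarrow> x \<in> U \<Longrightarrow> F x = f x"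
    "\<And>k. Ck_on k U G" "\<And>x. x \<in> S \<Longrightarrow> x \<in> U \<Longrightarrow> G x = g x"
    using smooth_mapE2[OF assms] by blast
  then show "\<exists>U F. open U \<and> p \<in> U \<and> (\<forall>k. Ck_on k U F) \<and> (\<forall>x\<in>S \<inter> U. F x = f x + g x)"
    by (intro exI[of _ U] exI[of _ "\<lambda>x. F x + G x"]) (auto intro: Ck_on_add)
qed

lemma smooth_map_Pair:
  assumes "smooth_map S f" "smooth_map S g"
  shows "smooth_map S (\<lambda>x. (f x, g x))"
proof -
  have "smooth_map S (\<lambda>x. (f x, 0) + (0, g x))"
    by (intro smooth_map_add smooth_map_linear[of "\<lambda>y. (y, 0)"] smooth_map_linear[of "\<lambda>y. (0, y)"] assms
        bounded_linear_Pair bounded_linear_ident bounded_linear_zero)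
  then show ?thesis by simp
qed

lemma has_derivative_transform_open_within:
  assumes "(F has_derivative F') (at p within S)" "open U" "p \<in> U" "p \<in> S"
    "\<And>x. x \<in> S \<Longrightarrow> x \<in> U \<Longrightarrow> F x = f x"
  shows "(f has_derivative F') (at p within S)"
proof -
  obtain e where "e > 0" "ball p e \<subseteq> U" using assms(2,3) open_contains_ball by blast
  then show ?thesis
    using assms(4,5) by (intro has_derivative_transform_within[OF assms(1), of e])
      (auto simp: subset_iff dist_commute)
qed

lemma smooth_map_differentiable:
  assumes "smooth_map S f" "p \<in> S"
  shows "f differentiable (at p within S)"
proof -
  obtain U F where U: "open U" "p \<in> U" "\<And>k. Ck_on k U F" "\<And>x. x \<in> S \<Longrightarrow> x \<in> U \<Longrightarrow> F x = f x"
    using smooth_mapE[OF assms] by blast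
  have "(F has_derivative frechet_derivative F (at p)) (at p within S)"
    using Ck_on_SucE[OF U(3) U(2)] by (rule has_derivative_at_withinI)
  then have "(f has_derivative frechet_derivative F (at p)) (at p within S)"
    by (rule has_derivative_transform_open_within[OF _ U(1,2) assms(2)]) (rule U(4))
  then show ?thesis by (rule differentiableI)
qed

section \<open>Derivatives along tangent vectors\<close>

text \<open>The curve never leaves \<open>S\<close>, so the chain rule needs a derivative of
  \<open>f\<close> within \<open>S\<close> only.\<close>

lemma curve_derivative:
  assumes "(f has_derivative f') (at p within S)" "\<And>t. \<sigma> t \<in> S" "\<sigma> 0 = p"
    "(\<sigma> has_vector_derivative v) (at (0::real))"
  shows "((\<lambda>t. f (\<sigma> t)) has_vector_derivative f' v) (at 0)"
proof -
  have "(f has_derivative f') (at (\<sigma> 0) within range \<sigma>)"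
    using assms(1-3) by (auto intro: has_derivative_subset)
  from diff_chain_within[OF assms(4)[unfolded has_vector_derivative_def] this]
  have "((f \<circ> \<sigma>) has_derivative f' \<circ> (\<lambda>x. x *\<^sub>R v)) (at 0)" .
  moreover have "f' \<circ> (\<lambda>x. x *\<^sub>R v) = (\<lambda>x. x *\<^sub>R f' v)"
    using has_derivative_bounded_linear[OF assms(1)] by (auto simp: linear_simps)
  ultimately show ?thesis by (simp add: has_vector_derivative_def o_def)
qed

text \<open>A derivative within \<open>S\<close> need not be unique as a linear map on the ambient
  space. On a tangent vector any two of them give the velocity at 0 of the same curve
  \<open>f (\<sigma> t)\<close>, and that velocity is unique.\<close>

lemma frechet_derivative_tangent:
  assumes "(f has_derivative f') (at p within S)" "v \<in> tangent_space S p"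
  shows "frechet_derivative f (at p within S) v = f' v"
proof -
  obtain \<sigma> where \<sigma>: "\<And>t. \<sigma> t \<in> S" "\<sigma> 0 = p" "(\<sigma> has_vector_derivative v) (at (0::real))"
    using assms(2) unfolding tangent_space_def by blast
  have "(f has_derivative frechet_derivative f (at p within S)) (at p within S)"
    using assms(1) by (metis differentiableI frechet_derivative_works)
  from curve_derivative[OF this \<sigma>] curve_derivative[OF assms(1) \<sigma>]
  show ?thesis by (rule vector_derivative_unique_at)
qed

lemma tangent_space_image:
  assumes "(f has_derivative f') (at p within S)" "v \<in> tangent_space S p" "f ` S \<subseteq> T"
  shows "f' v \<in> tangent_space T (f p)"
proof -
  obtain \<sigma> where \<sigma>: "\<And>t. \<sigma> t \<in> S" "\<sigma> 0 = p" "(\<sigma> has_vector_derivative v) (at (0::real))"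
    using assms(2) unfolding tangent_space_def by blast
  from curve_derivative[OF assms(1) \<sigma>] show ?thesis
    unfolding tangent_space_def using \<sigma> assms(3)
    by (intro CollectI exI[of _ "\<lambda>t. f (\<sigma> t)"]) auto
qed

lemma tangent_space_Times:
  fixes p :: "'a::euclidean_space \<times> 'b::euclidean_space"
  shows "tangent_space (A \<times> B) p = tangent_space A (fst p) \<times> tangent_space B (snd p)" (is "?L = ?R")
proof
  have 1: "fst v \<in> tangent_space A (fst p)" if "v \<in> ?L" for v
    by (rule tangent_space_image[OF _ that])
       (auto intro: bounded_linear_imp_has_derivative[OF bounded_linear_fst])
  have 2: "snd v \<in> tangent_space B (snd p)" if "v \<in> ?L" for v
    by (rule tangent_space_image[OF _ that])
       (auto intro: bounded_linear_imp_has_derivative[OF bounded_linear_snd])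
  show "?L \<subseteq> ?R" using 1 2 by (auto simp: mem_Times_iff)
  show "?R \<subseteq> ?L"
  proof
    fix v assume "v \<in> ?R"
    then have v': "fst v \<in> tangent_space A (fst p)" "snd v \<in> tangent_space B (snd p)" by auto
    from v'(1) obtain \<sigma> where \<sigma>: "\<And>t. \<sigma> t \<in> A" "\<sigma> 0 = fst p" "(\<sigma> has_vector_derivative fst v) (at (0::real))"
      unfolding tangent_space_def by blast
    from v'(2) obtain \<tau> where \<tau>: "\<And>t. \<tau> t \<in> B" "\<tau> 0 = snd p" "(\<tau> has_vector_derivative snd v) (at (0::real))"
      unfolding tangent_space_def by blast
    have "((\<lambda>t. (\<sigma> t, \<tau> t)) has_vector_derivative (fst v, snd v)) (at 0)"
      using \<sigma>(3) \<tau>(3) by (rule has_vector_derivative_Pair)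
    then show "v \<in> ?L"
      using \<sigma> \<tau> by (auto simp: tangent_space_def intro!: exI[of _ "\<lambda>t. (\<sigma> t, \<tau> t)"])
  qed
qed

section \<open>Directional derivatives along vector fields\<close>

lemma frechet_derivative_within_cong:
  assumes "p \<in> S" "\<And>x. x \<in> S \<Longrightarrow> f x = g x"
  shows "frechet_derivative f (at p within S) = frechet_derivative g (at p within S)"
proof -
  have "(f has_derivative f') (at p within S) \<longleftrightarrow> (g has_derivative f') (at p within S)" for f'
    using assms by (metis has_derivative_transform)
  then show ?thesis by (simp add: frechet_derivative_def)
qed

lemma dir_deriv_cong:
  "p \<in> S \<Longrightarrow> (\<And>x. x \<in> S \<Longrightarrow> f x = g x) \<Longrightarrow> dir_deriv S X f p = dir_deriv S X g p"
  unfolding dir_deriv_def by (metis frechet_derivative_within_cong)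

lemma dir_deriv_eq:
  "vector_field S X \<Longrightarrow> p \<in> S \<Longrightarrow> (f has_derivative f') (at p within S) \<Longrightarrow> dir_deriv S X f p = f' (X p)"
  unfolding dir_deriv_def vector_field_def by (auto intro: frechet_derivative_tangent)

lemma smooth_map_has_derivative:
  "smooth_map S f \<Longrightarrow> p \<in> S \<Longrightarrow> (f has_derivative frechet_derivative f (at p within S)) (at p within S)"
  using smooth_map_differentiable frechet_derivative_works by blast

lemma smooth_map_dir_deriv:
  assumes "vector_field S X" "smooth_map S f"
  shows "smooth_map S (dir_deriv S X f)"
  unfolding smooth_map_def
proof
  fix p assume "p \<in> S"
  moreover have "smooth_map S X" using assms(1) by (simp add: vector_field_def)
  ultimately obtain U F G where U: "open U" "p \<in> U" and F: "\<And>k. Ck_on k U F" "\<And>x. x \<in> S \<Longrightarrow> x \<in> U \<Longrightarrow> F x = f x"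
    and G: "\<And>k. Ck_on k U G" "\<And>x. x \<in> S \<Longrightarrow> x \<in> U \<Longrightarrow> G x = X x"
    using smooth_mapE2[OF assms(2), of X] by blast
  \<comment> \<open>The local extension of the directional derivative is DF(x)(G x). It is expanded
    in a basis because \<open>Ck_on\<close> controls derivatives in fixed directions only.\<close>
  define E where "E x = (\<Sum>b\<in>Basis. (G x \<bullet> b) *\<^sub>R frechet_derivative F (at x) b)" for x
  have dF: "(F has_derivative frechet_derivative F (at x)) (at x)" if "x \<in> U" for x
    using Ck_on_SucE[OF F(1) that] .
  have "Ck_on k U (\<lambda>x. frechet_derivative F (at x) b)" for k b
    using F(1)[of "Suc k"] by simp
  then have "Ck_on k U E" for k
    unfolding E_def
    by (intro Ck_on_sum Ck_on_bilinear[OF bounded_bilinear_scaleR] Ck_on_linear[OF bounded_linear_inner_left] G U) auto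
  moreover have "E x = dir_deriv S X f x" if x: "x \<in> S" "x \<in> U" for x
  proof -
    have "(f has_derivative frechet_derivative F (at x)) (at x within S)"
      by (rule has_derivative_transform_open_within[OF has_derivative_at_withinI[OF dF[OF x(2)]] U(1) x(2) x(1)])
         (rule F(2))
    then have "dir_deriv S X f x = frechet_derivative F (at x) (X x)"
      using dir_deriv_eq assms(1) x by blast
    also have "\<dots> = frechet_derivative F (at x) (\<Sum>b\<in>Basis. (X x \<bullet> b) *\<^sub>R b)"
      by (simp add: euclidean_representation)
    also have "\<dots> = (\<Sum>b\<in>Basis. (X x \<bullet> b) *\<^sub>R frechet_derivative F (at x) b)"
      using has_derivative_linear[OF dF[OF x(2)]] by (simp add: linear_sum linear_cmul)
    finally show ?thesis using G x by (simp add: E_def)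
  qed
  ultimately show "\<exists>U F. open U \<and> p \<in> U \<and> (\<forall>k. Ck_on k U F) \<and> (\<forall>x\<in>S \<inter> U. F x = dir_deriv S X f x)"
    using U by (intro exI[of _ U] exI[of _ E]) auto
qed

section \<open>Invariant structures on parallelized submanifolds\<close>

text \<open>The model is a matrix group with its left-invariant fields: \<open>frame p y\<close> is
  linear in \<open>p\<close> as well, so the derivative of \<open>p \<mapsto> frame p y\<close> in
  the direction \<open>frame p x\<close> is \<open>frame (frame p x) y\<close>. Hence the left side
  of \<open>frame_bracket\<close> is the Lie bracket of two invariant fields.\<close>

locale parallelization =
  fixes S :: "'a::euclidean_space set"
    and frame :: "'a \<Rightarrow> 'v::euclidean_space \<Rightarrow> 'a"
    and coframe :: "'a \<Rightarrow> 'a \<Rightarrow> 'v"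
    and bracket :: "'v \<Rightarrow> 'v \<Rightarrow> 'v"
  assumes bilinear_frame: "bounded_bilinear frame"
    and bilinear_coframe: "bounded_bilinear coframe"
    and tangent_frame: "p \<in> S \<Longrightarrow> tangent_space S p = range (frame p)"
    and coframe_frame: "p \<in> S \<Longrightarrow> coframe p (frame p x) = x"
    and frame_bracket: "p \<in> S \<Longrightarrow> frame (frame p x) y - frame (frame p y) x = frame p (bracket x y)"
begin

interpretation frame: bounded_bilinear frame by (fact bilinear_frame)
interpretation coframe: bounded_bilinear coframe by (fact bilinear_coframe)

lemma frame_tangent: "p \<in> S \<Longrightarrow> frame p x \<in> tangent_space S p"
  by (simp add: tangent_frame)

lemma frame_coframe: "p \<in> S \<Longrightarrow> v \<in> tangent_space S p \<Longrightarrow> frame p (coframe p v) = v"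
  by (auto simp: tangent_frame coframe_frame)

lemma tangent_add: "p \<in> S \<Longrightarrow> u \<in> tangent_space S p \<Longrightarrow> v \<in> tangent_space S p \<Longrightarrow> a *\<^sub>R u + v \<in> tangent_space S p"
  by (auto simp: tangent_frame frame.add_right[symmetric] frame.scaleR_right[symmetric])

lemma vector_field_coframe: "vector_field S X \<Longrightarrow> smooth_map S (\<lambda>p. coframe p (X p))"
  unfolding vector_field_def by (intro smooth_map_bilinear[OF bilinear_coframe] smooth_map_ident) simp

lemma vector_field_frame: "smooth_map S x \<Longrightarrow> vector_field S (\<lambda>p. frame p (x p))"
  unfolding vector_field_def
  by (simp add: frame_tangent smooth_map_bilinear[OF bilinear_frame] smooth_map_ident)

lemma vector_field_tangent: "vector_field S X \<Longrightarrow> p \<in> S \<Longrightarrow> X p \<in> tangent_space S p"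
  by (simp add: vector_field_def)

lemma dir_deriv_add:
  assumes "vector_field S X" "smooth_map S f" "smooth_map S g" "p \<in> S"
  shows "dir_deriv S X (\<lambda>p. f p + g p) p = dir_deriv S X f p + dir_deriv S X g p"
  using dir_deriv_eq[OF assms(1,4) has_derivative_add[OF smooth_map_has_derivative[OF assms(2,4)]
        smooth_map_has_derivative[OF assms(3,4)]]]
  by (simp add: dir_deriv_def)

lemma dir_deriv_linear:
  assumes "bounded_linear L" "vector_field S X" "smooth_map S f" "p \<in> S"
  shows "dir_deriv S X (\<lambda>p. L (f p)) p = L (dir_deriv S X f p)"
  using dir_deriv_eq[OF assms(2,4) bounded_linear.has_derivative[OF assms(1) smooth_map_has_derivative[OF assms(3,4)]]]
  by (simp add: dir_deriv_def)

lemma dir_deriv_bilinear: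
  assumes "bounded_bilinear b" "vector_field S X" "smooth_map S f" "smooth_map S g" "p \<in> S"
  shows "dir_deriv S X (\<lambda>p. b (f p) (g p)) p = b (f p) (dir_deriv S X g p) + b (dir_deriv S X f p) (g p)"
  using dir_deriv_eq[OF assms(2,5) bounded_bilinear.FDERIV[OF assms(1) smooth_map_has_derivative[OF assms(3,5)]
        smooth_map_has_derivative[OF assms(4,5)]]]
  by (simp add: dir_deriv_def)

text \<open>The Leibniz rule for \<open>Y p = frame p (coframe p (Y p))\<close> splits each
  derivative into one of the components and one of the frame; the frame terms combine to
  \<open>bracket\<close>.\<close>

lemma lie_bracket_coframe:
  assumes X: "vector_field S X" and Y: "vector_field S Y" and p: "p \<in> S"
  shows "lie_bracket S X Y p = frame p (dir_deriv S X (\<lambda>p. coframe p (Y p)) p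
    - dir_deriv S Y (\<lambda>p. coframe p (X p)) p + bracket (coframe p (X p)) (coframe p (Y p)))"
proof -
  have *: "dir_deriv S X Y p = frame p (dir_deriv S X (\<lambda>p. coframe p (Y p)) p) + frame (X p) (coframe p (Y p))"
    if X: "vector_field S X" and Y: "vector_field S Y" for X Y
  proof -
    have "dir_deriv S X Y p = dir_deriv S X (\<lambda>p. frame p (coframe p (Y p))) p"
      using Y by (intro dir_deriv_cong[OF p]) (simp add: frame_coframe vector_field_tangent)
    also have "\<dots> = frame p (dir_deriv S X (\<lambda>p. coframe p (Y p)) p) + frame (dir_deriv S X (\<lambda>p. p) p) (coframe p (Y p))"
      by (rule dir_deriv_bilinear[OF bilinear_frame X smooth_map_ident vector_field_coframe[OF Y] p])
    also have "dir_deriv S X (\<lambda>p. p) p = X p"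
      using dir_deriv_eq[OF X p has_derivative_ident] by simp
    finally show ?thesis .
  qed
  have "frame (X p) (coframe p (Y p)) - frame (Y p) (coframe p (X p))
      = frame p (bracket (coframe p (X p)) (coframe p (Y p)))"
    using frame_bracket[OF p, of "coframe p (X p)" "coframe p (Y p)"] vector_field_tangent[OF X p]
      vector_field_tangent[OF Y p] by (simp add: frame_coframe p)
  then show ?thesis
    by (simp add: lie_bracket_def *[OF X Y] *[OF Y X] frame.add_right frame.diff_right)
qed

end

text \<open>\<open>B\<close>, \<open>J\<close> and \<open>N\<close> are the metric, the almost
  complex structure and the connection coefficients, all constant in the frame.
  \<open>N_torsion\<close>, \<open>N_metric\<close> and \<open>N_J\<close> are the algebraic forms
  of vanishing torsion, metric compatibility and the nearly Kaehler condition. \<open>h\<close> and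
  \<open>JS\<close> have to match \<open>B\<close> and \<open>J\<close> on tangent vectors
  only.\<close>

locale invariant_nearly_kaehler = parallelization S frame coframe bracket
  for S :: "'a::euclidean_space set" and frame :: "'a \<Rightarrow> 'v::euclidean_space \<Rightarrow> 'a" and coframe bracket +
  fixes B :: "'v \<Rightarrow> 'v \<Rightarrow> real" and J :: "'v \<Rightarrow> 'v" and N :: "'v \<Rightarrow> 'v \<Rightarrow> 'v"
    and h :: "'a \<Rightarrow> 'a \<Rightarrow> 'a \<Rightarrow> real" and JS :: "'a \<Rightarrow> 'a \<Rightarrow> 'a"
  assumes bilinear_B: "bounded_bilinear B"
    and B_commute: "B x y = B y x"
    and B_nondegenerate: "(\<And>y. B x y = 0) \<Longrightarrow> x = 0"
    and linear_J: "bounded_linear J"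
    and J_J: "J (J x) = - x"
    and B_J: "B (J x) (J y) = B x y"
    and bilinear_N: "bounded_bilinear N"
    and N_torsion: "N x y - N y x = bracket x y"
    and N_metric: "B (N x y) z + B y (N x z) = 0"
    and N_J: "N x (J x) = J (N x x)"
    and h_eq: "p \<in> S \<Longrightarrow> v \<in> tangent_space S p \<Longrightarrow> w \<in> tangent_space S p \<Longrightarrow>
      h p v w = B (coframe p v) (coframe p w)"
    and JS_eq: "p \<in> S \<Longrightarrow> v \<in> tangent_space S p \<Longrightarrow> JS p v = frame p (J (coframe p v))"
begin

interpretation frame: bounded_bilinear frame by (fact bilinear_frame)
interpretation coframe: bounded_bilinear coframe by (fact bilinear_coframe)
interpretation B: bounded_bilinear B by (fact bilinear_B)
interpretation N: bounded_bilinear N by (fact bilinear_N)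
interpretation J: bounded_linear J by (fact linear_J)

definition D :: "('a \<Rightarrow> 'a) \<Rightarrow> ('a \<Rightarrow> 'a) \<Rightarrow> 'a \<Rightarrow> 'a" where
  "D X Y p = frame p (dir_deriv S X (\<lambda>p. coframe p (Y p)) p + N (coframe p (X p)) (coframe p (Y p)))"

lemma coframe_D:
  "p \<in> S \<Longrightarrow> coframe p (D X Y p) = dir_deriv S X (\<lambda>p. coframe p (Y p)) p + N (coframe p (X p)) (coframe p (Y p))"
  by (simp add: D_def coframe_frame)

lemma D_tangent: "p \<in> S \<Longrightarrow> D X Y p \<in> tangent_space S p"
  by (simp add: D_def frame_tangent)

lemma pseudo_metric: "pseudo_metric S h"
  unfolding pseudo_metric_def
proof (intro conjI ballI allI impI)
  fix p u v w a assume p: "p \<in> S" and "u \<in> tangent_space S p" "v \<in> tangent_space S p" "w \<in> tangent_space S p"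
  then show "h p (a *\<^sub>R u + v) w = a * h p u w + h p v w"
    by (simp add: h_eq tangent_add coframe.add_right coframe.scaleR_right B.add_left B.scaleR_left)
next
  fix p v w assume p: "p \<in> S" and "v \<in> tangent_space S p" "w \<in> tangent_space S p"
  then show "h p v w = h p w v" by (simp add: h_eq B_commute)
next
  fix p v assume p: "p \<in> S" and v: "v \<in> tangent_space S p" and 0: "\<forall>w\<in>tangent_space S p. h p v w = 0"
  have "B (coframe p v) y = 0" for y
    using 0[rule_format, OF frame_tangent[OF p, of y]] by (simp add: h_eq p v frame_tangent coframe_frame)
  then have "coframe p v = 0" by (rule B_nondegenerate)
  then show "v = 0" using frame_coframe[OF p v] by (simp add: frame.zero_right)
next
  fix X Y assume X: "vector_field S X" and Y: "vector_field S Y"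
  have "smooth_map S (\<lambda>p. B (coframe p (X p)) (coframe p (Y p)))"
    by (intro smooth_map_bilinear[OF bilinear_B] vector_field_coframe X Y)
  then show "smooth_map S (\<lambda>p. h p (X p) (Y p))"
    by (rule smooth_map_cong[THEN iffD1, rotated]) (simp add: h_eq X Y vector_field_tangent)
qed

lemma vector_field_JS: "vector_field S X \<Longrightarrow> vector_field S (\<lambda>p. JS p (X p))"
proof -
  assume X: "vector_field S X"
  have "vector_field S (\<lambda>p. frame p (J (coframe p (X p))))"
    by (intro vector_field_frame smooth_map_linear[OF linear_J] vector_field_coframe X)
  moreover have "smooth_map S (\<lambda>p. JS p (X p)) \<longleftrightarrow> smooth_map S (\<lambda>p. frame p (J (coframe p (X p))))"
    by (rule smooth_map_cong) (simp add: JS_eq X vector_field_tangent)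
  ultimately show ?thesis
    by (simp add: vector_field_def JS_eq X[THEN vector_field_tangent] frame_tangent)
qed

lemma almost_pseudo_hermitian: "almost_pseudo_hermitian S h JS"
  unfolding almost_pseudo_hermitian_def
proof (intro conjI ballI allI impI)
  fix p v w a assume p: "p \<in> S" and "v \<in> tangent_space S p" "w \<in> tangent_space S p"
  then show "JS p (a *\<^sub>R v + w) = a *\<^sub>R JS p v + JS p w"
    by (simp add: JS_eq tangent_add coframe.add_right coframe.scaleR_right J.add J.scaleR frame.add_right frame.scaleR_right)
next
  fix p v assume p: "p \<in> S" and v: "v \<in> tangent_space S p"
  then show J: "JS p v \<in> tangent_space S p" by (simp add: JS_eq frame_tangent)
  show "JS p (JS p v) = - v"
    using JS_eq[OF p J] by (simp add: JS_eq[OF p v] p v coframe_frame J_J frame.minus_right frame_coframe)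
next
  fix p v w assume p: "p \<in> S" and "v \<in> tangent_space S p" "w \<in> tangent_space S p"
  then show "h p (JS p v) (JS p w) = h p v w"
    by (simp add: JS_eq h_eq frame_tangent coframe_frame B_J)
qed (rule pseudo_metric, rule vector_field_JS)

lemma connection_D: "connection S D"
  unfolding connection_def
proof (intro conjI ballI allI impI)
  fix X Y assume X: "vector_field S X" and Y: "vector_field S Y"
  show "vector_field S (D X Y)"
    unfolding D_def[abs_def]
    by (intro vector_field_frame smooth_map_add smooth_map_dir_deriv smooth_map_bilinear[OF bilinear_N]
        vector_field_coframe X Y)
next
  fix X X' Y p assume X: "vector_field S X" "vector_field S X'" and Y: "vector_field S Y" and p: "p \<in> S"
  interpret d: bounded_linear "frechet_derivative (\<lambda>p. coframe p (Y p)) (at p within S)"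
    using smooth_map_has_derivative[OF vector_field_coframe[OF Y] p] by (rule has_derivative_bounded_linear)
  show "D (\<lambda>x. X x + X' x) Y p = D X Y p + D X' Y p"
    by (simp add: D_def dir_deriv_def d.add coframe.add_right N.add_left frame.add_right algebra_simps)
next
  fix X Y p and \<phi> :: "'a \<Rightarrow> real" assume X: "vector_field S X" and Y: "vector_field S Y" and p: "p \<in> S"
  interpret d: bounded_linear "frechet_derivative (\<lambda>p. coframe p (Y p)) (at p within S)"
    using smooth_map_has_derivative[OF vector_field_coframe[OF Y] p] by (rule has_derivative_bounded_linear)
  show "D (\<lambda>x. \<phi> x *\<^sub>R X x) Y p = \<phi> p *\<^sub>R D X Y p"
    by (simp add: D_def dir_deriv_def d.scaleR coframe.scaleR_right N.scaleR_left frame.scaleR_right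
        frame.add_right algebra_simps)
next
  fix X Y Y' p assume X: "vector_field S X" and Y: "vector_field S Y" "vector_field S Y'" and p: "p \<in> S"
  have "dir_deriv S X (\<lambda>p. coframe p (Y p + Y' p)) p
      = dir_deriv S X (\<lambda>p. coframe p (Y p)) p + dir_deriv S X (\<lambda>p. coframe p (Y' p)) p"
    by (simp add: coframe.add_right dir_deriv_add[OF X Y[THEN vector_field_coframe] p])
  then show "D X (\<lambda>x. Y x + Y' x) p = D X Y p + D X Y' p"
    unfolding D_def by (simp only:)
      (simp add: coframe.add_right N.add_right frame.add_right add_ac)
next
  fix X Y p and \<phi> :: "'a \<Rightarrow> real"
  assume \<phi>: "smooth_map S \<phi>" and X: "vector_field S X" and Y: "vector_field S Y" and p: "p \<in> S"
  have "D X (\<lambda>x. \<phi> x *\<^sub>R Y x) p = dir_deriv S X \<phi> p *\<^sub>R frame p (coframe p (Y p)) + \<phi> p *\<^sub>R D X Y p"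
    by (simp add: D_def coframe.scaleR_right N.scaleR_right frame.add_right frame.scaleR_right
        dir_deriv_bilinear[OF bounded_bilinear_scaleR X \<phi> vector_field_coframe[OF Y] p] algebra_simps)
  then show "D X (\<lambda>x. \<phi> x *\<^sub>R Y x) p = dir_deriv S X \<phi> p *\<^sub>R Y p + \<phi> p *\<^sub>R D X Y p"
    by (simp add: frame_coframe p vector_field_tangent Y)
qed

text \<open>The torsion reduces to \<open>N_torsion\<close> by the component formula for the
  bracket. Since \<open>B\<close> is constant in the frame, its derivative is given by the Leibniz
  rule, and the \<open>N\<close> terms on the other side cancel by \<open>N_metric\<close>.\<close>

lemma levi_civita_D: "levi_civita S h D"
  unfolding levi_civita_def
proof (intro conjI ballI allI impI)
  fix X Y p assume X: "vector_field S X" and Y: "vector_field S Y" and p: "p \<in> S"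
  have "D X Y p - D Y X p = frame p (dir_deriv S X (\<lambda>p. coframe p (Y p)) p - dir_deriv S Y (\<lambda>p. coframe p (X p)) p
      + (N (coframe p (X p)) (coframe p (Y p)) - N (coframe p (Y p)) (coframe p (X p))))"
    by (simp add: D_def frame.add_right frame.diff_right algebra_simps)
  then show "D X Y p - D Y X p = lie_bracket S X Y p"
    by (simp add: lie_bracket_coframe X Y p N_torsion)
next
  fix X Y Z p assume X: "vector_field S X" and Y: "vector_field S Y" and Z: "vector_field S Z" and p: "p \<in> S"
  have "dir_deriv S X (\<lambda>x. h x (Y x) (Z x)) p = dir_deriv S X (\<lambda>p. B (coframe p (Y p)) (coframe p (Z p))) p"
    by (rule dir_deriv_cong[OF p]) (simp add: h_eq Y Z vector_field_tangent)
  also have "\<dots> = B (coframe p (Y p)) (dir_deriv S X (\<lambda>p. coframe p (Z p)) p)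
      + B (dir_deriv S X (\<lambda>p. coframe p (Y p)) p) (coframe p (Z p))"
    by (rule dir_deriv_bilinear[OF bilinear_B X vector_field_coframe[OF Y] vector_field_coframe[OF Z] p])
  also have "\<dots> = B (coframe p (D X Y p)) (coframe p (Z p)) + B (coframe p (Y p)) (coframe p (D X Z p))"
    using N_metric[of "coframe p (X p)" "coframe p (Y p)" "coframe p (Z p)"]
    by (simp add: coframe_D p B.add_left B.add_right)
  also have "\<dots> = h p (D X Y p) (Z p) + h p (Y p) (D X Z p)"
    by (simp add: h_eq p Y Z vector_field_tangent D_tangent)
  finally show "dir_deriv S X (\<lambda>x. h x (Y x) (Z x)) p = h p (D X Y p) (Z p) + h p (Y p) (D X Z p)" .
qed (rule connection_D)

text \<open>\<open>J\<close> is constant in the frame and so commutes with differentiation of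
  components; only the constant terms remain, and \<open>N_J\<close> settles them.\<close>

theorem nearly_pseudo_kaehler: "nearly_pseudo_kaehler S h JS"
  unfolding nearly_pseudo_kaehler_def
proof (intro conjI exI allI impI ballI)
  fix X p assume X: "vector_field S X" and p: "p \<in> S"
  have J: "coframe p (JS p (X p)) = J (coframe p (X p))" if "p \<in> S" for p
    using that by (simp add: JS_eq X vector_field_tangent coframe_frame)
  have "dir_deriv S X (\<lambda>p. coframe p (JS p (X p))) p = dir_deriv S X (\<lambda>p. J (coframe p (X p))) p"
    by (rule dir_deriv_cong[OF p]) (rule J)
  also have "\<dots> = J (dir_deriv S X (\<lambda>p. coframe p (X p)) p)"
    by (rule dir_deriv_linear[OF linear_J X vector_field_coframe[OF X] p])
  finally have "D X (\<lambda>x. JS x (X x)) p = frame p (J (coframe p (D X X p)))"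
    by (simp add: D_def J p N_J J.add coframe_frame)
  then show "D X (\<lambda>x. JS x (X x)) p - JS p (D X X p) = 0"
    by (simp add: JS_eq p D_tangent)
qed (rule almost_pseudo_hermitian, rule levi_civita_D)

end

section \<open>Two-by-two matrices\<close>

lemma cmat_eq_iff: "(A::cmat) = B \<longleftrightarrow> A$1$1 = B$1$1 \<and> A$1$2 = B$1$2 \<and> A$2$1 = B$2$1 \<and> A$2$2 = B$2$2"
  by (auto simp: vec_eq_iff forall_2)

lemma vec3_eq_iff: "(X::real^3) = Y \<longleftrightarrow> X$0 = Y$0 \<and> X$1 = Y$1 \<and> X$2 = Y$2"
proof -
  \<comment> \<open>\<open>forall_3\<close> runs over the indices 1, 2, 3, while the coordinates are
    named 0, 1, 2.\<close>
  have 3: "(3::3) = 0" by simp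
  show ?thesis unfolding vec_eq_iff forall_3 3 by auto
qed

text \<open>The adjugate. It is linear in \<open>A\<close> and equals the inverse when the
  determinant is one, so on the group it replaces \<open>matrix_inv\<close> by a map that is its own
  derivative.\<close>

definition adj2 :: "cmat \<Rightarrow> cmat" where
  "adj2 A = vector [vector [A$2$2, - A$1$2], vector [- A$2$1, A$1$1]]"

lemma mult_entry: "((A::cmat) ** B)$i$j = A$i$1 * B$1$j + A$i$2 * B$2$j"
  by (simp add: matrix_matrix_mult_def sum_2)

lemma mat_entry: "(mat a :: cmat)$1$1 = a" "(mat a :: cmat)$1$2 = 0" "(mat a :: cmat)$2$1 = 0" "(mat a :: cmat)$2$2 = a"
  by (simp_all add: mat_def)

lemma dagger_entry: "dagger A $ i $ j = cnj (A $ j $ i)"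
  by (simp add: dagger_def)

lemma adj2_entry: "adj2 A $1$1 = A$2$2" "adj2 A $1$2 = - A$1$2" "adj2 A $2$1 = - A$2$1" "adj2 A $2$2 = A$1$1"
  by (simp_all add: adj2_def)

lemmas entries = cmat_eq_iff mult_entry mat_entry dagger_entry adj2_entry

lemma bounded_bilinear_mult: "bounded_bilinear (\<lambda>(A::cmat) (B::cmat). A ** B)"
  unfolding bilinear_conv_bounded_bilinear[symmetric] bilinear_def linear_iff
  by (simp add: entries algebra_simps)

lemma bounded_linear_dagger: "bounded_linear dagger"
  unfolding linear_conv_bounded_linear[symmetric] linear_iff by (simp add: entries)

lemma bounded_linear_adj2: "bounded_linear adj2"
  unfolding linear_conv_bounded_linear[symmetric] linear_iff by (simp add: entries)

lemmas mult_simps = bounded_bilinear.add_left[OF bounded_bilinear_mult] bounded_bilinear.add_right[OF bounded_bilinear_mult]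
  bounded_bilinear.diff_left[OF bounded_bilinear_mult] bounded_bilinear.diff_right[OF bounded_bilinear_mult]
  bounded_bilinear.minus_left[OF bounded_bilinear_mult] bounded_bilinear.minus_right[OF bounded_bilinear_mult]
  bounded_bilinear.scaleR_left[OF bounded_bilinear_mult] bounded_bilinear.scaleR_right[OF bounded_bilinear_mult]

lemmas dagger_simps = linear_simps[OF bounded_linear_dagger]
lemmas adj2_simps = linear_simps[OF bounded_linear_adj2]

lemma dagger_mult: "dagger (A ** B) = dagger B ** dagger A"
  by (simp add: entries)

lemma dagger_dagger [simp]: "dagger (dagger A) = A"
  by (simp add: entries)

lemma adj2_adj2 [simp]: "adj2 (adj2 A) = A"
  by (simp add: entries)

lemma adj2_mult: "adj2 (A ** B) = adj2 B ** adj2 A"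
  by (simp add: entries)

lemma det_dagger: "det (dagger A) = cnj (det A)"
  by (simp add: det_2 entries)

lemma det_adj2: "det (adj2 A) = det A"
  by (simp add: det_2 entries mult.commute)

lemma mult_adj2: "A ** adj2 A = mat (det A)" "adj2 A ** A = mat (det A)"
  by (simp_all add: det_2 entries)

lemma matrix_inv_eq_adj2:
  assumes "det A = 1"
  shows "matrix_inv A = adj2 A"
proof -
  have "A ** matrix_inv A = mat 1 \<and> matrix_inv A ** A = mat 1"
    unfolding matrix_inv_def by (rule someI[where x = "adj2 A"]) (simp add: mult_adj2 assms)
  then have "adj2 A ** (A ** matrix_inv A) = adj2 A" by simp
  then show ?thesis by (simp add: matrix_mul_assoc mult_adj2 assms)
qed

definition tr :: "cmat \<Rightarrow> complex" where
  "tr A = A$1$1 + A$2$2"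

lemma tr_commute: "tr (A ** B) = tr (B ** A)"
  by (simp add: tr_def entries)

lemma tr_add: "tr (A + B) = tr A + tr B" and tr_diff: "tr (A - B) = tr A - tr B"
  and tr_uminus: "tr (- A) = - tr A" and tr_scaleR: "tr (a *\<^sub>R A) = a *\<^sub>R tr A"
  by (simp_all add: tr_def algebra_simps)

section \<open>The groups and their Lie algebras\<close>

text \<open>\<open>Hgrp r\<close> consists of the elements of determinant one in a real form of the algebra of
  complex matrices: the quaternions for \<open>r = 0\<close>, the split quaternions for \<open>r = 1\<close>.\<close>

definition Qalg :: "nat \<Rightarrow> cmat set" where
  "Qalg r = {A. A$2$2 = cnj (A$1$1) \<and> A$1$2 = - ((-1) ^ r) * cnj (A$2$1)}"

text \<open>Multiplying the quadratic equation of the group by \<open>adj2 A\<close> on the right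
  turns it, at determinant one, into an equation linear over the reals in the entries of
  \<open>A\<close>, namely membership in \<open>Qalg r\<close>.\<close>

lemma Hgrp_iff: "A \<in> Hgrp r \<longleftrightarrow> A \<in> Qalg r \<and> det A = 1"
proof (cases "det A = 1")
  case True
  have "dagger A ** herm_form r ** A = herm_form r \<longleftrightarrow> dagger A ** herm_form r = herm_form r ** adj2 A"
  proof
    assume "dagger A ** herm_form r ** A = herm_form r"
    then have "dagger A ** herm_form r ** (A ** adj2 A) = herm_form r ** adj2 A"
      by (simp add: matrix_mul_assoc)
    then show "dagger A ** herm_form r = herm_form r ** adj2 A" by (simp add: mult_adj2 True)
  next
    assume "dagger A ** herm_form r = herm_form r ** adj2 A"
    then have "dagger A ** herm_form r ** A = herm_form r ** (adj2 A ** A)"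
      by (simp add: matrix_mul_assoc)
    then show "dagger A ** herm_form r ** A = herm_form r" by (simp add: mult_adj2 True)
  qed
  also have "\<dots> \<longleftrightarrow> A \<in> Qalg r"
    by (cases "even r") (auto simp: herm_form_def entries Qalg_def complex_eq_iff)
  finally show ?thesis using True by (simp add: Hgrp_def)
qed (simp add: Hgrp_def)

lemma Qalg_mult: "A \<in> Qalg r \<Longrightarrow> B \<in> Qalg r \<Longrightarrow> A ** B \<in> Qalg r"
  by (cases "even r") (auto simp: Qalg_def entries algebra_simps)

lemma Qalg_adj2: "A \<in> Qalg r \<Longrightarrow> adj2 A \<in> Qalg r"
  by (cases "even r") (auto simp: Qalg_def entries)

lemma Qalg_dagger: "A \<in> Qalg r \<Longrightarrow> dagger A \<in> Qalg r"
  by (cases "even r") (auto simp: Qalg_def entries)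

lemma Qalg_mat_1: "mat 1 \<in> Qalg r"
  by (simp add: Qalg_def entries)

lemma Qalg_add: "A \<in> Qalg r \<Longrightarrow> B \<in> Qalg r \<Longrightarrow> A + B \<in> Qalg r"
  by (auto simp: Qalg_def algebra_simps)

lemma Qalg_scaleR: "A \<in> Qalg r \<Longrightarrow> a *\<^sub>R A \<in> Qalg r"
  by (auto simp: Qalg_def algebra_simps)

lemma Hgrp_det: "A \<in> Hgrp r \<Longrightarrow> det A = 1" and Hgrp_Qalg: "A \<in> Hgrp r \<Longrightarrow> A \<in> Qalg r"
  by (simp_all add: Hgrp_iff)

lemma Hgrp_mult: "A \<in> Hgrp r \<Longrightarrow> B \<in> Hgrp r \<Longrightarrow> A ** B \<in> Hgrp r"
  by (simp add: Hgrp_iff Qalg_mult det_mul)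

lemma Hgrp_adj2: "A \<in> Hgrp r \<Longrightarrow> adj2 A \<in> Hgrp r"
  by (simp add: Hgrp_iff Qalg_adj2 det_adj2)

lemma Hgrp_dagger: "A \<in> Hgrp r \<Longrightarrow> dagger A \<in> Hgrp r"
  by (simp add: Hgrp_iff Qalg_dagger det_dagger)

lemma Hgrp_mat_1: "mat 1 \<in> Hgrp r"
  by (simp add: Hgrp_iff Qalg_mat_1)

lemma Hgrp_inv: "A \<in> Hgrp r \<Longrightarrow> matrix_inv A = adj2 A"
  by (simp add: Hgrp_iff matrix_inv_eq_adj2)

lemma adj2_cancel:
  assumes "A \<in> Hgrp r"
  shows "adj2 A ** A = mat 1" "A ** adj2 A = mat 1" "adj2 A ** (A ** B) = B" "A ** (adj2 A ** B) = B"
  using mult_adj2[of A] Hgrp_det[OF assms] by (simp_all add: matrix_mul_assoc)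

section \<open>The Lie algebra as the tangent space at the identity\<close>

definition lie :: "nat \<Rightarrow> cmat set" where
  "lie r = {U \<in> Qalg r. tr U = 0}"

lemma lie_add: "U \<in> lie r \<Longrightarrow> V \<in> lie r \<Longrightarrow> U + V \<in> lie r"
  by (simp add: lie_def Qalg_add tr_add)

lemma lie_scaleR: "U \<in> lie r \<Longrightarrow> a *\<^sub>R U \<in> lie r"
  by (simp add: lie_def Qalg_scaleR tr_scaleR)

lemma lie_diff: "U \<in> lie r \<Longrightarrow> V \<in> lie r \<Longrightarrow> U - V \<in> lie r"
  using lie_add[of U r "- 1 *\<^sub>R V"] lie_scaleR[of V r "- 1"] by simp

lemma lie_dagger: "U \<in> lie r \<Longrightarrow> dagger U \<in> lie r"
  by (simp add: lie_def Qalg_dagger) (auto simp: tr_def dagger_entry simp flip: complex_cnj_add)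

text \<open>Both \<open>f'\<close> and the zero map are derivatives of \<open>f\<close> within
  \<open>S\<close>, so they agree on tangent vectors.\<close>

lemma tangent_space_const:
  assumes "(f has_derivative f') (at p within S)" "v \<in> tangent_space S p" "p \<in> S" "\<And>x. x \<in> S \<Longrightarrow> f x = c"
  shows "f' v = 0"
proof -
  have "(f has_derivative (\<lambda>_. 0)) (at p within S)"
    by (rule has_derivative_transform[OF assms(3) _ has_derivative_const]) (rule assms(4))
  from frechet_derivative_tangent[OF this assms(2)] frechet_derivative_tangent[OF assms(1,2)]
  show ?thesis by simp
qed

text \<open>The defining equations are differentiated: the linear ones of \<open>Qalg r\<close>
  carry over to \<open>v\<close>, and the determinant has the trace as its derivative at the
  identity.\<close>

lemma tangent_Hgrp_1_subset:
  assumes "v \<in> tangent_space (Hgrp r) (mat 1)"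
  shows "v \<in> lie r"
proof -
  have "bounded_linear (\<lambda>A::cmat. A$2$2 - cnj (A$1$1))" "bounded_linear (\<lambda>A::cmat. A$1$2 + (-1) ^ r * cnj (A$2$1))"
    unfolding linear_conv_bounded_linear[symmetric] linear_iff by (simp_all add: algebra_simps)
  note this[THEN bounded_linear_imp_has_derivative, THEN tangent_space_const, OF assms Hgrp_mat_1]
  from this[where c = 0] have "v \<in> Qalg r"
    by (simp add: Hgrp_iff Qalg_def eq_neg_iff_add_eq_0)
  moreover have "((\<lambda>A::cmat. A$1$1 * A$2$2 - A$1$2 * A$2$1) has_derivative tr) (at (mat 1) within Hgrp r)"
  proof -
    have "bounded_linear (\<lambda>A::cmat. A$i$j)" for i j
      unfolding linear_conv_bounded_linear[symmetric] linear_iff by simp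
    note e = bounded_linear_imp_has_derivative[OF this]
    show ?thesis
      by (rule has_derivative_eq_rhs[OF has_derivative_diff[OF has_derivative_mult[OF e e] has_derivative_mult[OF e e]]])
        (simp add: tr_def mat_entry fun_eq_iff)
  qed
  from tangent_space_const[OF this assms Hgrp_mat_1, of 1] have "tr v = 0"
    by (simp add: Hgrp_iff det_2)
  ultimately show ?thesis by (simp add: lie_def)
qed

text \<open>The cross term of the determinant is a multiple of the trace of \<open>U\<close>, hence
  zero, and the symmetry of \<open>Qalg r\<close> makes \<open>det U\<close> real.\<close>

lemma det_lie:
  assumes "U \<in> lie r"
  shows "det (a *\<^sub>R mat 1 + b *\<^sub>R U) = of_real (a^2 + b^2 * Re (det U))"
proof -
  have U: "U$2$2 = - U$1$1" "U$2$2 = cnj (U$1$1)" "U$1$2 = - ((-1) ^ r) * cnj (U$2$1)"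
    using assms by (auto simp: lie_def Qalg_def tr_def eq_neg_iff_add_eq_0 add.commute)
  have "Im (det U) = 0" by (simp add: det_2 U(2,3) minus_one_power_iff)
  then have "det U = of_real (Re (det U))" by (simp add: complex_eq_iff)
  moreover have "det (a *\<^sub>R mat 1 + b *\<^sub>R U) = of_real a ^ 2 + of_real b ^ 2 * det U"
    by (simp add: det_2 mat_entry U(1) scaleR_conv_of_real[where 'a = complex] power2_eq_square algebra_simps)
  ultimately show ?thesis by simp
qed

lemma tangent_Hgrp_1_supset:
  assumes U: "U \<in> lie r"
  shows "U \<in> tangent_space (Hgrp r) (mat 1)"
proof -
  define d where "d = Re (det U)"
  \<comment> \<open>In place of the exponential, the coefficient of the identity is chosen by
    \<open>det_lie\<close> to give determinant one. Away from 0, where the root could fail, the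
    curve is set to the identity: a tangent curve must stay in the group for all \<open>t\<close>
    but is differentiated at 0 only.\<close>
  define \<sigma> where "\<sigma> t = (if d * t^2 < 1 then sqrt (1 - d * t^2) *\<^sub>R mat 1 + t *\<^sub>R U else mat 1)" for t
  have "((\<lambda>t. sqrt (1 - d * t^2) *\<^sub>R mat 1 + t *\<^sub>R U) has_vector_derivative U) (at 0)"
    by (auto intro!: derivative_eq_intros simp: has_vector_derivative_def)
  moreover have "open {t. d * t^2 < 1}"
    by (intro open_Collect_less continuous_intros)
  ultimately have "(\<sigma> has_vector_derivative U) (at 0)"
    by (rule has_vector_derivative_transform_within_open) (auto simp: \<sigma>_def)
  moreover have "\<sigma> t \<in> Hgrp r" for t
    using U det_lie[OF U, folded d_def]
    by (simp add: \<sigma>_def Hgrp_mat_1)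
      (simp add: Hgrp_iff lie_def Qalg_add Qalg_scaleR Qalg_mat_1 flip: of_real_power of_real_mult of_real_add)
  moreover have "\<sigma> 0 = mat 1" by (simp add: \<sigma>_def)
  ultimately show ?thesis unfolding tangent_space_def by blast
qed

text \<open>Left translations are linear on the matrix space and preserve the group; translating by
  \<open>p\<close> and by \<open>adj2 p\<close> carries the tangent spaces at \<open>mat 1\<close>
  and \<open>p\<close> into each other.\<close>

lemma tangent_Hgrp:
  assumes p: "p \<in> Hgrp r"
  shows "tangent_space (Hgrp r) p = (\<lambda>U. p ** U) ` lie r"
proof -
  have tr: "A ** v \<in> tangent_space (Hgrp r) (A ** B)"
    if "A \<in> Hgrp r" "v \<in> tangent_space (Hgrp r) B" for A B v
    using that
    by (intro tangent_space_image[OF bounded_linear_imp_has_derivative[OF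
            bounded_bilinear.bounded_linear_right[OF bounded_bilinear_mult]]])
      (auto simp: Hgrp_mult)
  show ?thesis
  proof (intro equalityI subsetI)
    fix v assume "v \<in> tangent_space (Hgrp r) p"
    from tr[OF Hgrp_adj2[OF p] this] have "adj2 p ** v \<in> lie r"
      by (intro tangent_Hgrp_1_subset) (simp add: adj2_cancel[OF p])
    then show "v \<in> (\<lambda>U. p ** U) ` lie r"
      by (rule rev_image_eqI) (simp add: adj2_cancel[OF p])
  next
    fix v assume "v \<in> (\<lambda>U. p ** U) ` lie r"
    then show "v \<in> tangent_space (Hgrp r) p"
      using tr[OF p tangent_Hgrp_1_supset] by auto
  qed
qed

section \<open>The identification of the model space with the Lie algebra\<close>

lemma gam_entry:
  "gam r X $1$1 = (if r = 0 then \<i> * X$0 else X$0)" "gam r X $1$2 = X$1 + \<i> * X$2"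
  "gam r X $2$1 = - X$1 + \<i> * X$2" "gam r X $2$2 = (if r = 0 then - \<i> * X$0 else - X$0)"
  by (simp_all add: gam_def gamma0_def gamma1_def gamma2_def complex_eq_iff)

lemma lg_entry: "lg r X $i$j = \<i> ^ r / 2 * gam r X $i$j"
proof -
  have "mat a ** A = (\<chi> i j. a * A$i$j)" for a and A :: cmat by (simp add: entries)
  then show ?thesis by (simp add: lg_def)
qed

text \<open>A linear extension of the inverse of \<open>lg r\<close> to all matrices.\<close>

definition linv :: "nat \<Rightarrow> cmat \<Rightarrow> real^3" where
  "linv r U = (\<chi> i. if i = 0 then 2 * Im (U$1$1)
     else if i = 1 then (if r = 0 then - 2 * Re (U$2$1) else - 2 * Im (U$2$1))
     else (if r = 0 then 2 * Im (U$2$1) else - 2 * Re (U$2$1)))"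

lemma linv_entry: "linv r U $ 0 = 2 * Im (U$1$1)"
    "linv r U $ 1 = (if r = 0 then - 2 * Re (U$2$1) else - 2 * Im (U$2$1))"
    "linv r U $ 2 = (if r = 0 then 2 * Im (U$2$1) else - 2 * Re (U$2$1))"
  by (simp_all add: linv_def)

lemma bounded_linear_lg: "bounded_linear (lg r)"
  unfolding linear_conv_bounded_linear[symmetric] linear_iff
  by (simp add: entries lg_entry gam_entry algebra_simps scaleR_conv_of_real[where 'a = complex])

lemma bounded_linear_linv: "bounded_linear (linv r)"
  unfolding linear_conv_bounded_linear[symmetric] linear_iff
  by (simp add: vec3_eq_iff linv_entry algebra_simps)

lemmas lg_simps = linear_simps[OF bounded_linear_lg]
lemmas linv_simps = linear_simps[OF bounded_linear_linv]

lemma lg_Complex: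
  assumes "r \<in> {0, 1}"
  shows "lg r X $1$1 = Complex 0 (X$0 / 2)" "lg r X $2$2 = Complex 0 (- X$0 / 2)"
    "lg r X $1$2 = (if r = 0 then Complex (X$1 / 2) (X$2 / 2) else Complex (- X$2 / 2) (X$1 / 2))"
    "lg r X $2$1 = (if r = 0 then Complex (- X$1 / 2) (X$2 / 2) else Complex (- X$2 / 2) (- X$1 / 2))"
  using assms by (auto simp: lg_entry gam_entry complex_eq_iff)

lemma linv_lg: "r \<in> {0, 1} \<Longrightarrow> linv r (lg r X) = X"
  by (auto simp: vec3_eq_iff linv_entry lg_Complex)

lemma lg_linv: "r \<in> {0, 1} \<Longrightarrow> U \<in> lie r \<Longrightarrow> lg r (linv r U) = U"
  by (cases "U$1$1"; cases "U$2$1")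
    (auto simp: cmat_eq_iff linv_entry lg_Complex lie_def tr_def Qalg_def complex_eq_iff)

lemma lg_lie: "r \<in> {0, 1} \<Longrightarrow> lg r X \<in> lie r"
  by (auto simp: lg_Complex lie_def tr_def Qalg_def complex_eq_iff)

lemma inv_lg: "r \<in> {0, 1} \<Longrightarrow> U \<in> lie r \<Longrightarrow> inv (lg r) U = linv r U"
  by (metis injI inv_f_f lg_linv linv_lg)

text \<open>The cross product of \<open>ip r\<close> for the given orientation; raising the index 0
  with the metric produces the sign in that entry. The factor 1/2 in \<open>lg\<close> makes it
  correspond exactly to the commutator (\<open>lg_crs\<close>).\<close>

definition crs :: "nat \<Rightarrow> real^3 \<Rightarrow> real^3 \<Rightarrow> real^3" where
  "crs r X Y = (\<chi> i. if i = 0 then (-1) ^ r * (X$1 * Y$2 - X$2 * Y$1)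
     else if i = 1 then X$2 * Y$0 - X$0 * Y$2 else X$0 * Y$1 - X$1 * Y$0)"

lemma crs_entry: "crs r X Y $ 0 = (-1) ^ r * (X$1 * Y$2 - X$2 * Y$1)"
  "crs r X Y $ 1 = X$2 * Y$0 - X$0 * Y$2" "crs r X Y $ 2 = X$0 * Y$1 - X$1 * Y$0"
  by (simp_all add: crs_def)

lemma lg_crs: "r \<in> {0, 1} \<Longrightarrow> lg r X ** lg r Y - lg r Y ** lg r X = lg r (crs r X Y)"
  by (auto simp: cmat_eq_iff mult_entry lg_Complex crs_entry complex_eq_iff field_simps)

text \<open>Turns the metric into the trace form, so that later symmetry claims follow from the
  cyclicity of the trace.\<close>

lemma ip_eq_tr: "r \<in> {0, 1} \<Longrightarrow> ip r X Y = - ((-1) ^ r) * 2 * Re (tr (lg r X ** lg r Y))"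
  by (auto simp: ip_def tr_def mult_entry lg_Complex field_simps)

lemma bounded_bilinear_ip: "bounded_bilinear (ip r)"
  unfolding bilinear_conv_bounded_bilinear[symmetric] bilinear_def linear_iff
  by (simp add: ip_def algebra_simps)

lemma bounded_bilinear_crs: "bounded_bilinear (crs r)"
  unfolding bilinear_conv_bounded_bilinear[symmetric] bilinear_def linear_iff
  by (simp add: vec3_eq_iff crs_entry algebra_simps)

section \<open>The invariant nearly pseudo-Kaehler structure of the spin bundle\<close>

text \<open>\<open>spin_frame r p (X, Z)\<close> is the value at \<open>p\<close> of \<open>X\<^sup>H + U\<^sup>#\<close> with \<open>U = lg r Z\<close>.\<close>

definition spin_frame :: "nat \<Rightarrow> cmat \<times> cmat \<Rightarrow> (real^3) \<times> (real^3) \<Rightarrow> cmat \<times> cmat" where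
  "spin_frame r p x = (fst p ** (lg r (fst x) + lg r (snd x)), snd p ** dagger (lg r (fst x) - lg r (snd x)))"

text \<open>The pair of the solder form and the connection form pulled back by \<open>lg\<close>,
  written with \<open>adj2\<close> and \<open>linv\<close> so that it is bilinear on the whole
  ambient space; it agrees with the forms on tangent vectors.\<close>

definition spin_coframe :: "nat \<Rightarrow> cmat \<times> cmat \<Rightarrow> cmat \<times> cmat \<Rightarrow> (real^3) \<times> (real^3)" where
  "spin_coframe r p v =
    (linv r ((1/2) *\<^sub>R (adj2 (fst p) ** fst v + dagger (adj2 (snd p) ** snd v))),
     linv r ((1/2) *\<^sub>R (adj2 (fst p) ** fst v - dagger (adj2 (snd p) ** snd v))))"

text \<open>The bracket of the product Lie algebra in horizontal and vertical components. The dagger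
  in the second factor reverses products and contributes a sign, which yields the relations of a
  symmetric pair: two horizontal arguments give a vertical bracket, mixed ones a horizontal
  bracket.\<close>

definition spin_bracket :: "nat \<Rightarrow> (real^3) \<times> (real^3) \<Rightarrow> (real^3) \<times> (real^3) \<Rightarrow> (real^3) \<times> (real^3)" where
  "spin_bracket r x y = (crs r (fst x) (snd y) + crs r (snd x) (fst y), crs r (fst x) (fst y) + crs r (snd x) (snd y))"

lemma bounded_bilinear_spin_frame: "bounded_bilinear (spin_frame r)"
  unfolding bilinear_conv_bounded_bilinear[symmetric] bilinear_def linear_iff
  by (simp add: spin_frame_def mult_simps lg_simps dagger_simps algebra_simps)

lemma bounded_bilinear_spin_coframe: "bounded_bilinear (spin_coframe r)"
  unfolding bilinear_conv_bounded_bilinear[symmetric] bilinear_def linear_iff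
  by (simp add: spin_coframe_def mult_simps linv_simps dagger_simps adj2_simps algebra_simps)

context
  fixes r :: nat
  assumes r: "r \<in> {0, 1}"
begin

lemma inv_lg_lg: "inv (lg r) (lg r X) = X"
  by (simp only: inv_lg[OF r lg_lie[OF r]] linv_lg[OF r])

lemma forms_spin_frame:
  assumes "p \<in> spin_bundle r"
  shows "(1/2) *\<^sub>R (omegaL p (spin_frame r p x) + dagger (omegaR p (spin_frame r p x))) = lg r (fst x)"
    and "connection_form p (spin_frame r p x) = lg r (snd x)"
    and "solder_form r p (spin_frame r p x) = fst x"
    and "spin_coframe r p (spin_frame r p x) = x"
proof -
  have p: "fst p \<in> Hgrp r" "snd p \<in> Hgrp r" using assms by (auto simp: spin_bundle_def)
  have L: "omegaL p (spin_frame r p x) = lg r (fst x) + lg r (snd x)"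
    and R: "omegaR p (spin_frame r p x) = dagger (lg r (fst x) - lg r (snd x))"
    by (simp_all add: omegaL_def omegaR_def spin_frame_def Hgrp_inv[OF p(1)] Hgrp_inv[OF p(2)]
        adj2_cancel[OF p(1)] adj2_cancel[OF p(2)])
  show 1: "(1/2) *\<^sub>R (omegaL p (spin_frame r p x) + dagger (omegaR p (spin_frame r p x))) = lg r (fst x)"
    by (simp add: L R scaleR_2[symmetric])
  then show "solder_form r p (spin_frame r p x) = fst x"
    by (simp add: solder_form_def inv_lg_lg)
  show 2: "connection_form p (spin_frame r p x) = lg r (snd x)"
    by (simp add: connection_form_def L R scaleR_2[symmetric])
  show "spin_coframe r p (spin_frame r p x) = x"
    using 1 2 by (simp add: spin_coframe_def connection_form_def omegaL_def omegaR_def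
        Hgrp_inv[OF p(1)] Hgrp_inv[OF p(2)] linv_lg[OF r])
qed

lemma tangent_spin_bundle:
  assumes "p \<in> spin_bundle r"
  shows "tangent_space (spin_bundle r) p = range (spin_frame r p)"
proof -
  have p: "fst p \<in> Hgrp r" "snd p \<in> Hgrp r" using assms by (auto simp: spin_bundle_def)
  have "v \<in> range (spin_frame r p)" if v: "v \<in> (\<lambda>U. fst p ** U) ` lie r \<times> (\<lambda>U. snd p ** U) ` lie r" for v
  proof -
    obtain U V where v': "v = (fst p ** U, snd p ** V)" and UV: "U \<in> lie r" "V \<in> lie r"
      using v by auto
    have l: "(1/2) *\<^sub>R (U + dagger V) \<in> lie r" "(1/2) *\<^sub>R (U - dagger V) \<in> lie r"
      using UV by (auto intro: lie_scaleR lie_add lie_diff lie_dagger)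
    \<comment> \<open>Half the sum and half the difference of \<open>U\<close> and
      \<open>dagger V\<close> are the values of the solder form (before undoing \<open>lg\<close>)
      and of the connection form.\<close>
    have "v = spin_frame r p (linv r ((1/2) *\<^sub>R (U + dagger V)), linv r ((1/2) *\<^sub>R (U - dagger V)))"
      by (simp only: spin_frame_def fst_conv snd_conv lg_linv[OF r l(1)] lg_linv[OF r l(2)] v')
        (simp add: scaleR_add_right[symmetric] scaleR_diff_right[symmetric] scaleR_2[symmetric])
    then show ?thesis by blast
  qed
  moreover have "spin_frame r p x \<in> (\<lambda>U. fst p ** U) ` lie r \<times> (\<lambda>U. snd p ** U) ` lie r" for x
    unfolding spin_frame_def by (auto intro!: imageI lie_dagger lie_add lie_diff lg_lie[OF r])
  ultimately show ?thesis
    unfolding spin_bundle_def tangent_space_Times tangent_Hgrp[OF p(1)] tangent_Hgrp[OF p(2)] by blast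
qed

lemma spin_frame_bracket:
  "spin_frame r (spin_frame r p x) y - spin_frame r (spin_frame r p y) x = spin_frame r p (spin_bracket r x y)"
proof -
  have c: "lg r (crs r X Y) = lg r X ** lg r Y - lg r Y ** lg r X" for X Y
    using lg_crs[OF r] by simp
  show ?thesis
    by (simp add: spin_frame_def spin_bracket_def lg_simps c mult_simps dagger_simps dagger_mult
        matrix_mul_assoc algebra_simps)
qed

section \<open>The structures of the bundle in the invariant frame\<close>

lemma solder_connection_coframe:
  assumes "p \<in> spin_bundle r" "v \<in> tangent_space (spin_bundle r) p"
  shows "solder_form r p v = fst (spin_coframe r p v)"
    and "connection_form p v = lg r (snd (spin_coframe r p v))"
    and "inv (lg r) (connection_form p v) = snd (spin_coframe r p v)"
  using assms by (auto simp: tangent_spin_bundle forms_spin_frame inv_lg_lg)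

lemma horizontal_eq:
  assumes p: "p \<in> spin_bundle r"
  shows "horizontal r X p = spin_frame r p (X, 0)"
  unfolding horizontal_def
proof (rule the_equality)
  show "spin_frame r p (X, 0) \<in> tangent_space (spin_bundle r) p \<and>
      solder_form r p (spin_frame r p (X, 0)) = X \<and> connection_form p (spin_frame r p (X, 0)) = 0"
    by (simp add: tangent_spin_bundle p forms_spin_frame lg_simps)
next
  fix v assume v: "v \<in> tangent_space (spin_bundle r) p \<and> solder_form r p v = X \<and> connection_form p v = 0"
  then obtain x where x: "v = spin_frame r p x" using tangent_spin_bundle[OF p] by auto
  then have "fst x = X" "lg r (snd x) = 0" using v by (simp_all add: forms_spin_frame p)
  moreover from this(2) have "snd x = 0" using linv_lg[OF r, of "snd x"] by (simp add: linv_simps)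
  ultimately show "v = spin_frame r p (X, 0)" using x by (cases x) simp
qed

text \<open>On the group the inverse in the action is \<open>adj2\<close>, so the orbit map is the
  restriction of the linear map \<open>?f\<close>, which is its own derivative; \<open>adj2\<close>
  is negation on the Lie algebra.\<close>

lemma fundamental_eq:
  assumes p: "p \<in> spin_bundle r"
  shows "fundamental r (lg r Z) p = spin_frame r p (0, Z)"
proof -
  let ?f = "\<lambda>h. (fst p ** h, snd p ** dagger (adj2 h))"
  have "bounded_linear ?f"
    unfolding linear_conv_bounded_linear[symmetric] linear_iff
    by (simp add: mult_simps dagger_simps adj2_simps)
  then have "(?f has_derivative ?f) (at (mat 1) within Hgrp r)"
    by (rule bounded_linear_imp_has_derivative)
  then have "(right_action p has_derivative ?f) (at (mat 1) within Hgrp r)"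
    by (rule has_derivative_transform[rotated 2]) (simp_all add: Hgrp_mat_1 right_action_def Hgrp_inv)
  then have "fundamental r (lg r Z) p = ?f (lg r Z)"
    unfolding fundamental_def by (rule frechet_derivative_tangent) (intro tangent_Hgrp_1_supset lg_lie r)
  also have "adj2 (lg r Z) = - lg r Z"
    using lg_lie[OF r, of Z] by (auto simp: lie_def tr_def entries eq_neg_iff_add_eq_0 add.commute)
  finally show ?thesis by (simp add: spin_frame_def lg_simps)
qed

lemma Jc_eq:
  assumes "p \<in> spin_bundle r" "v \<in> tangent_space (spin_bundle r) p"
  shows "Jc r c p v = spin_frame r p (- (1/c) *\<^sub>R snd (spin_coframe r p v), c *\<^sub>R fst (spin_coframe r p v))"
proof -
  have "Jc r c p v = spin_frame r p (- (1/c) *\<^sub>R snd (spin_coframe r p v), 0)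
      + spin_frame r p (0, c *\<^sub>R fst (spin_coframe r p v))"
    by (simp add: Jc_def solder_connection_coframe[OF assms] horizontal_eq fundamental_eq assms(1)
        inv_lg_lg lg_simps[symmetric] del: lg_simps)
  also have "\<dots> = spin_frame r p (- (1/c) *\<^sub>R snd (spin_coframe r p v), c *\<^sub>R fst (spin_coframe r p v))"
    by (simp add: bounded_bilinear.add_right[OF bounded_bilinear_spin_frame, symmetric])
  finally show ?thesis .
qed

lemma Gc_Jc:
  assumes "c \<noteq> 0" "p \<in> spin_bundle r" "v \<in> tangent_space (spin_bundle r) p" "w \<in> tangent_space (spin_bundle r) p"
  shows "Gc r c p (Jc r c p v) w = Omega r p v w"
proof -
  interpret ip: bounded_bilinear "ip r" by (rule bounded_bilinear_ip)
  have "Jc r c p v \<in> tangent_space (spin_bundle r) p"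
    using assms by (simp add: Jc_eq tangent_spin_bundle)
  note J = solder_connection_coframe[OF assms(2) this]
  show ?thesis
    unfolding Gc_def Omega_def J solder_connection_coframe[OF assms(2,3)] solder_connection_coframe[OF assms(2,4)]
    using assms(1) by (simp add: inv_lg_lg Jc_eq[OF assms(2,3)] forms_spin_frame assms(2)
        ip.scaleR_left ip.minus_left)
qed

lemma crs_commute: "crs r X Y = - crs r Y X"
  by (simp add: vec3_eq_iff crs_entry algebra_simps)

text \<open>Both sides are the determinant with rows \<open>X\<close>, \<open>Y\<close>,
  \<open>Z\<close>.\<close>

lemma ip_crs: "ip r (crs r X Y) Z = ip r X (crs r Y Z)"
  using r by (auto simp: ip_def crs_entry algebra_simps)

lemma ip_commute: "ip r X Y = ip r Y X"
  by (simp add: ip_def)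

text \<open>Read off from the Koszul formula for the left-invariant metric with \<open>c\<^sup>2 = 3\<close>. For general \<open>c\<close>
  the coefficients are \<open>1 - 1/(2 c\<^sup>2)\<close>, \<open>1/(2 c\<^sup>2)\<close> and \<open>1/2\<close>, and \<open>(\<nabla>\<^sub>X J) X\<close> vanishes only for \<open>c\<^sup>2 = 3\<close>.\<close>

definition spin_conn :: "(real^3) \<times> (real^3) \<Rightarrow> (real^3) \<times> (real^3) \<Rightarrow> (real^3) \<times> (real^3)" where
  "spin_conn x y = ((5/6) *\<^sub>R crs r (snd x) (fst y) + (1/6) *\<^sub>R crs r (fst x) (snd y),
    (1/2) *\<^sub>R (crs r (snd x) (snd y) + crs r (fst x) (fst y)))"

theorem nearly_pseudo_kaehler_spin_bundle:
  "nearly_pseudo_kaehler (spin_bundle r) (Gc r (sqrt 3)) (Jc r (sqrt 3))"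
proof -
  let ?c = "sqrt 3"
  interpret ip: bounded_bilinear "ip r" by (rule bounded_bilinear_ip)
  interpret crs: bounded_bilinear "crs r" by (rule bounded_bilinear_crs)
  define B where "B x y = ?c * ip r (fst x) (fst y) + (1/?c) * ip r (snd x) (snd y)" for x y
  define J where "J x = (- (1/?c) *\<^sub>R snd x, ?c *\<^sub>R fst x)" for x :: "(real^3) \<times> (real^3)"
  have nondeg: "X = 0" if 0: "\<And>Y. ip r X Y = 0" for X
    using 0[of "axis 0 1"] 0[of "axis 1 1"] 0[of "axis 2 1"] by (simp add: ip_def vec3_eq_iff axis_def)
  \<comment> \<open>All scalars become rational multiples of the single root
    \<open>?c\<close>.\<close>
  have c: "1 / ?c = ?c / 3" by (simp add: field_simps)
  have cc: "?c * (?c * a) = 3 * a" for a by (simp flip: mult.assoc)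
  have crs_self: "crs r X X = 0" for X by (simp add: vec3_eq_iff crs_entry)
  \<comment> \<open>Multiplication by \<open>U\<close> in the cross product is skew for
    \<open>ip r\<close>; metric compatibility rests on this.\<close>
  have triple: "ip r (crs r U X) Y = - ip r X (crs r U Y)" for U X Y
    by (metis crs_commute ip.minus_right ip_commute ip_crs)
  interpret invariant_nearly_kaehler "spin_bundle r" "spin_frame r" "spin_coframe r" "spin_bracket r"
    B J spin_conn "Gc r ?c" "Jc r ?c"
  proof (intro invariant_nearly_kaehler.intro parallelization.intro invariant_nearly_kaehler_axioms.intro)
    show "bounded_bilinear (spin_frame r)" by (rule bounded_bilinear_spin_frame)
    show "bounded_bilinear (spin_coframe r)" by (rule bounded_bilinear_spin_coframe)
  next
    fix p x y assume p: "p \<in> spin_bundle r"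
    show "tangent_space (spin_bundle r) p = range (spin_frame r p)" by (rule tangent_spin_bundle[OF p])
    show "spin_coframe r p (spin_frame r p x) = x" by (rule forms_spin_frame[OF p])
    show "spin_frame r (spin_frame r p x) y - spin_frame r (spin_frame r p y) x = spin_frame r p (spin_bracket r x y)"
      by (rule spin_frame_bracket)
  next
    show "bounded_bilinear B"
      unfolding bilinear_conv_bounded_bilinear[symmetric] bilinear_def linear_iff
      by (simp add: B_def ip.add_left ip.add_right ip.scaleR_left ip.scaleR_right algebra_simps add_divide_distrib)
    show "bounded_linear J"
      unfolding linear_conv_bounded_linear[symmetric] linear_iff by (simp add: J_def algebra_simps)
    show "bounded_bilinear spin_conn"
      unfolding bilinear_conv_bounded_bilinear[symmetric] bilinear_def linear_iff
      by (simp add: spin_conn_def crs.add_left crs.add_right crs.scaleR_left crs.scaleR_right algebra_simps)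
  next
    fix x y z :: "(real^3) \<times> (real^3)"
    show "B x y = B y x" by (simp add: B_def ip_commute)
    show "J (J x) = - x" by (cases x) (simp add: J_def)
    show "B (J x) (J y) = B x y"
      by (simp add: B_def J_def c cc ip.scaleR_left ip.scaleR_right ip.minus_left ip.minus_right)
    show "spin_conn x y - spin_conn y x = spin_bracket r x y"
      by (simp add: spin_conn_def spin_bracket_def crs_commute[of "snd y" "fst x"] crs_commute[of "fst y" "snd x"]
          crs_commute[of "snd y" "snd x"] crs_commute[of "fst y" "fst x"] vec3_eq_iff field_simps)
    \<comment> \<open>The terms in \<open>fst x\<close> cancel against each other since their
      weights agree: \<open>?c\<close> times 1/6 equals \<open>1 / ?c\<close> times 1/2.\<close>
    show "B (spin_conn x y) z + B y (spin_conn x z) = 0"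
      by (simp add: B_def spin_conn_def c ip.add_left ip.add_right ip.scaleR_left ip.scaleR_right triple algebra_simps
          del: divide_divide_eq_left)
    \<comment> \<open>Products of a vector with itself vanish. What is left is a multiple of
      \<open>crs r (snd x) (fst x)\<close> in the vertical part, with coefficients
      \<open>(?c + 1 / ?c) / 2\<close> and \<open>2 / 3 * ?c\<close>, equal because the square of
      \<open>?c\<close> is 3.\<close>
    show "spin_conn x (J x) = J (spin_conn x x)"
      by (simp add: J_def spin_conn_def c crs.scaleR_right crs.minus_right crs_self crs_commute[of "fst x" "snd x"]
          vec3_eq_iff algebra_simps)
  next
    fix x assume 0: "\<And>y. B x y = 0"
    have "fst x = 0" using 0[of "(_, 0)"] by (intro nondeg) (simp add: B_def ip.zero_right)
    moreover have "snd x = 0" using 0[of "(0, _)"] by (intro nondeg) (simp add: B_def ip.zero_right)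
    ultimately show "x = 0" by (simp add: prod_eq_iff)
  next
    fix p v w assume p: "p \<in> spin_bundle r" and v: "v \<in> tangent_space (spin_bundle r) p"
    show "Jc r ?c p v = spin_frame r p (J (spin_coframe r p v))"
      unfolding J_def by (rule Jc_eq[OF p v])
    assume w: "w \<in> tangent_space (spin_bundle r) p"
    show "Gc r ?c p v w = B (spin_coframe r p v) (spin_coframe r p w)"
      by (simp only: Gc_def B_def solder_connection_coframe[OF p v] solder_connection_coframe[OF p w]
          inv_lg_lg)
  qed
  show ?thesis by (rule nearly_pseudo_kaehler)
qed

end

section \<open>Lagrangian sections\<close>

lemma lie_adj2: "U \<in> lie r \<Longrightarrow> adj2 U = - U"
  by (auto simp: lie_def tr_def entries eq_neg_iff_add_eq_0 add.commute)

lemma mat_mult_commute: "(A::cmat) ** mat a = mat a ** A"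
  by (simp add: entries mult.commute)

lemma tr_mat_mult: "tr (mat a ** A) = a * tr A"
  by (simp add: tr_def entries algebra_simps)

text \<open>On tangent vectors both forms take values in the image of \<open>lg r\<close>, so
  \<open>inv (lg r)\<close> disappears once the metric is the trace form.\<close>

lemma Omega_eq_tr:
  assumes r: "r \<in> {0, 1}" and p: "p \<in> spin_bundle r"
    and v: "v \<in> tangent_space (spin_bundle r) p" and w: "w \<in> tangent_space (spin_bundle r) p"
  shows "Omega r p v w = - ((-1) ^ r) * 2 * Re
    (tr ((1/2) *\<^sub>R (omegaL p v + dagger (omegaR p v)) ** connection_form p w)
     - tr (connection_form p v ** ((1/2) *\<^sub>R (omegaL p w + dagger (omegaR p w)))))"
proof -
  obtain x y where xy: "v = spin_frame r p x" "w = spin_frame r p y"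
    using v w tangent_spin_bundle[OF r p] by auto
  show ?thesis
    unfolding Omega_def xy forms_spin_frame[OF r p] inv_lg_lg[OF r] ip_eq_tr[OF r]
    by (simp add: algebra_simps)
qed

lemma spin_section_adj2: "f q \<in> Hgrp r \<Longrightarrow> spin_section f q = (q ** f q, dagger (adj2 (f q)))"
  by (simp add: spin_section_def Hgrp_inv)

lemma spin_section_mem:
  assumes "f \<in> Hgrp r \<rightarrow> Hgrp r" "q \<in> Hgrp r"
  shows "spin_section f q \<in> spin_bundle r"
  using funcset_mem[OF assms] assms(2)
  by (simp add: spin_section_adj2[of f q r] spin_bundle_def Hgrp_mult Hgrp_dagger Hgrp_adj2)

lemma bundle_section_spin_section:
  assumes f: "f \<in> Hgrp r \<rightarrow> Hgrp r" and smooth: "smooth_map (Hgrp r) f"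
  shows "bundle_section r (spin_section f)"
proof -
  have *: "f q \<in> Hgrp r" if "q \<in> Hgrp r" for q using funcset_mem[OF f that] .
  have "smooth_map (Hgrp r) (\<lambda>q. (q ** f q, dagger (adj2 (f q))))"
    by (intro smooth_map_Pair smooth_map_bilinear[OF bounded_bilinear_mult] smooth_map_ident
        smooth_map_linear[OF bounded_linear_dagger] smooth_map_linear[OF bounded_linear_adj2] smooth)
  then have "smooth_map (Hgrp r) (spin_section f)"
    by (rule smooth_map_cong[THEN iffD1, rotated]) (simp add: spin_section_adj2[of f, OF *])
  moreover have "bundle_proj (spin_section f q) = q" if "q \<in> Hgrp r" for q
    by (simp add: bundle_proj_def spin_section_adj2[of f, OF *[OF that]] adj2_cancel[OF *[OF that]]
        flip: matrix_mul_assoc)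
  ultimately show ?thesis using spin_section_mem[OF f] by (auto simp: bundle_section_def)
qed

lemma spin_section_derivative:
  assumes f: "f \<in> Hgrp r \<rightarrow> Hgrp r" and q: "q \<in> Hgrp r"
    and f': "(f has_derivative f') (at q within Hgrp r)" and v: "v \<in> tangent_space (Hgrp r) q"
  shows "frechet_derivative (spin_section f) (at q within Hgrp r) v = (v ** f q + q ** f' v, dagger (adj2 (f' v)))"
    and "frechet_derivative (spin_section f) (at q within Hgrp r) v \<in> tangent_space (spin_bundle r) (spin_section f q)"
proof -
  have *: "f q \<in> Hgrp r" if "q \<in> Hgrp r" for q using funcset_mem[OF f that] .
  let ?s' = "\<lambda>v. (v ** f q + q ** f' v, dagger (adj2 (f' v)))"
  have "((\<lambda>q. (q ** f q, dagger (adj2 (f q)))) has_derivative ?s') (at q within Hgrp r)"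
    using bounded_bilinear.FDERIV[OF bounded_bilinear_mult has_derivative_ident f']
      bounded_linear.has_derivative[OF bounded_linear_dagger bounded_linear.has_derivative[OF bounded_linear_adj2 f']]
    by (intro has_derivative_Pair) (simp_all add: add.commute)
  then have s': "(spin_section f has_derivative ?s') (at q within Hgrp r)"
    by (rule has_derivative_transform[OF q, rotated]) (simp add: spin_section_adj2[of f, OF *])
  show 1: "frechet_derivative (spin_section f) (at q within Hgrp r) v = ?s' v"
    by (rule frechet_derivative_tangent[OF s' v])
  show "frechet_derivative (spin_section f) (at q within Hgrp r) v \<in> tangent_space (spin_bundle r) (spin_section f q)"
    unfolding 1 by (rule tangent_space_image[OF s' v]) (auto intro: spin_section_mem[OF f])
qed

text \<open>Along the section the left Maurer-Cartan form is \<open>S V + F V\<close> and the dagger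
  of the right one is \<open>- F V\<close>, so the solder part is half of \<open>S V\<close> and the
  connection part is that plus \<open>F V\<close>. The terms with two factors \<open>S\<close>
  cancel by symmetry of the trace; conjugating by \<open>f q\<close> removes \<open>S\<close> from
  the rest.\<close>

lemma pullback_Omega_eq_tr:
  assumes r: "r \<in> {0, 1}" and f: "f \<in> Hgrp r \<rightarrow> Hgrp r" and q: "q \<in> Hgrp r"
    and f': "(f has_derivative f') (at q within Hgrp r)"
    and V: "V \<in> lie r" and W: "W \<in> lie r"
  shows "pullback2 (Hgrp r) (spin_section f) (Omega r) q (q ** V) (q ** W) = - ((-1) ^ r) * Re
    (tr (V ** (f' (q ** W) ** adj2 (f q))) - tr (f' (q ** V) ** adj2 (f q) ** W))"
proof -
  have fq: "f q \<in> Hgrp r" using funcset_mem[OF f q] .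
  define S where "S V = adj2 (f q) ** V ** f q" for V
  define F where "F V = adj2 (f q) ** f' (q ** V)" for V
  have T: "q ** V \<in> tangent_space (Hgrp r) q" if "V \<in> lie r" for V
    using that by (simp add: tangent_Hgrp[OF q])
  define ds where "ds V = frechet_derivative (spin_section f) (at q within Hgrp r) (q ** V)" for V
  have ds: "ds V = (q ** V ** f q + q ** f' (q ** V), dagger (adj2 (f' (q ** V))))" if "V \<in> lie r" for V
    unfolding ds_def by (rule spin_section_derivative(1)[OF f q f' T[OF that]])
  have ds_tangent: "ds V \<in> tangent_space (spin_bundle r) (spin_section f q)" if "V \<in> lie r" for V
    unfolding ds_def by (rule spin_section_derivative(2)[OF f q f' T[OF that]])
  \<comment> \<open>The derivative is tangent to the group at \<open>f q\<close>, hence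
    \<open>f q ** U\<close> with \<open>U\<close> in the Lie algebra, where \<open>adj2\<close> is
    negation.\<close>
  have F: "adj2 (f' (q ** V)) ** f q = - F V" if "V \<in> lie r" for V
  proof -
    have "f' (q ** V) \<in> tangent_space (Hgrp r) (f q)"
      using f by (intro tangent_space_image[OF f' T[OF that]]) auto
    then obtain U where U: "U \<in> lie r" "f' (q ** V) = f q ** U" using tangent_Hgrp[OF fq] by auto
    show ?thesis
      by (simp add: F_def U(2) adj2_mult lie_adj2[OF U(1)] mult_simps adj2_cancel[OF fq] flip: matrix_mul_assoc)
  qed
  have L: "omegaL (spin_section f q) (ds V) = S V + F V" if "V \<in> lie r" for V
    using that by (simp add: omegaL_def ds spin_section_adj2[of f, OF fq] Hgrp_inv[OF Hgrp_mult[OF q fq]] adj2_mult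
        mult_simps S_def F_def adj2_cancel[OF q] flip: matrix_mul_assoc)
  have R: "dagger (omegaR (spin_section f q) (ds V)) = - F V" if "V \<in> lie r" for V
  proof -
    have "adj2 (dagger (adj2 A)) = dagger A" for A by (simp add: entries)
    then show ?thesis
      using that by (simp add: omegaR_def ds spin_section_adj2[of f, OF fq] Hgrp_inv[OF Hgrp_dagger[OF Hgrp_adj2[OF fq]]]
          dagger_mult F)
  qed
  have SF: "tr (S V ** F W) = tr (V ** (f' (q ** W) ** adj2 (f q)))" for V W
  proof -
    have "tr (S V ** F W) = tr (adj2 (f q) ** (V ** f' (q ** W)))"
      by (simp add: S_def F_def adj2_cancel[OF fq] flip: matrix_mul_assoc)
    also have "\<dots> = tr (V ** f' (q ** W) ** adj2 (f q))" by (rule tr_commute)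
    finally show ?thesis by (simp add: matrix_mul_assoc)
  qed
  have solder: "(1/2) *\<^sub>R (omegaL (spin_section f q) (ds V) + dagger (omegaR (spin_section f q) (ds V))) = (1/2) *\<^sub>R S V"
    and connection: "connection_form (spin_section f q) (ds V) = (1/2) *\<^sub>R S V + F V" if "V \<in> lie r" for V
    by (simp_all add: connection_form_def L[OF that] R[OF that] scaleR_add_right scaleR_left_distrib[symmetric]
        flip: add.assoc)
  have "pullback2 (Hgrp r) (spin_section f) (Omega r) q (q ** V) (q ** W) = Omega r (spin_section f q) (ds V) (ds W)"
    by (simp add: pullback2_def ds_def)
  also have "\<dots> = - ((-1) ^ r) * Re (tr (S V ** F W) - tr (S W ** F V))"
    unfolding Omega_eq_tr[OF r spin_section_mem[OF f q] ds_tangent[OF V] ds_tangent[OF W]]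
      solder[OF V] solder[OF W] connection[OF V] connection[OF W]
    by (simp add: mult_simps tr_add tr_scaleR tr_commute[of "S V" "S W"] tr_commute[of "F V" "S W"] algebra_simps)
  also have "tr (S W ** F V) = tr (f' (q ** V) ** adj2 (f q) ** W)"
    unfolding SF by (rule tr_commute)
  finally show ?thesis by (simp only: SF)
qed

lemma lagrangian_sectionI:
  assumes r: "r \<in> {0, 1}" and f: "f \<in> Hgrp r \<rightarrow> Hgrp r" and smooth: "smooth_map (Hgrp r) f"
    and f': "\<And>q. q \<in> Hgrp r \<Longrightarrow> (f has_derivative f' q) (at q within Hgrp r)"
    and sym: "\<And>q V W. q \<in> Hgrp r \<Longrightarrow> V \<in> lie r \<Longrightarrow> W \<in> lie r \<Longrightarrow>
      tr (V ** (f' q (q ** W) ** adj2 (f q))) = tr (f' q (q ** V) ** adj2 (f q) ** W)"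
  shows "lagrangian_section r (Omega r) (spin_section f)"
  unfolding lagrangian_section_def
  using bundle_section_spin_section[OF f smooth] pullback_Omega_eq_tr[OF r f _ f'] sym
  by (auto simp: tangent_Hgrp)

text \<open>The identity \<open>Gc_Jc\<close> holds on tangent vectors of the bundle, and the
  differential of the section produces only such vectors.\<close>

lemma lagrangian_section_Gc_Jc:
  assumes r: "r \<in> {0, 1}" and f: "f \<in> Hgrp r \<rightarrow> Hgrp r" and c: "c \<noteq> 0"
    and L: "lagrangian_section r (Omega r) (spin_section f)"
  shows "lagrangian_section r (\<lambda>p v w. Gc r c p (Jc r c p v) w) (spin_section f)"
proof -
  let ?s = "spin_section f"
  have smooth: "smooth_map (Hgrp r) ?s" using L by (simp add: lagrangian_section_def bundle_section_def)
  have "frechet_derivative ?s (at q within Hgrp r) v \<in> tangent_space (spin_bundle r) (?s q)"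
    if "q \<in> Hgrp r" "v \<in> tangent_space (Hgrp r) q" for q v
    by (rule tangent_space_image[OF smooth_map_has_derivative[OF smooth that(1)] that(2)])
      (auto intro: spin_section_mem[OF f])
  then show ?thesis
    using L by (simp add: lagrangian_section_def pullback2_def Gc_Jc[OF r c] spin_section_mem[OF f])
qed

lemma has_derivative_mult_matrix:
  fixes f g :: "'a::real_normed_vector \<Rightarrow> cmat"
  assumes "(f has_derivative f') (at q within S)" "(g has_derivative g') (at q within S)"
  shows "((\<lambda>q. f q ** g q) has_derivative (\<lambda>v. f q ** g' v + f' v ** g q)) (at q within S)"
  using bounded_bilinear.FDERIV[OF bounded_bilinear_mult assms] .

section \<open>The individual families of maps\<close>

lemma lagrangian_fKplus:
  assumes r: "r \<in> {0, 1}"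
  shows "lagrangian_section r (Omega r) (spin_section fKplus)"
  unfolding fKplus_def[abs_def]
  by (rule lagrangian_sectionI[OF r, where f' = "\<lambda>_ _. 0"])
    (auto intro: Hgrp_mat_1 smooth_map_const simp: bounded_bilinear.zero_left[OF bounded_bilinear_mult]
      bounded_bilinear.zero_right[OF bounded_bilinear_mult])

text \<open>Lets a map given by an inverse or by a definite description be replaced by a polynomial
  map that agrees with it on the group only.\<close>

lemma spin_section_cong:
  assumes "\<And>q. q \<in> Hgrp r \<Longrightarrow> f q = g q"
  shows "lagrangian_section r \<omega> (spin_section f) \<longleftrightarrow> lagrangian_section r \<omega> (spin_section g)"
proof -
  have s: "spin_section f q = spin_section g q" if "q \<in> Hgrp r" for q
    using assms[OF that] by (simp add: spin_section_def)
  have "frechet_derivative (spin_section f) (at q within Hgrp r) = frechet_derivative (spin_section g) (at q within Hgrp r)"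
    if "q \<in> Hgrp r" for q by (rule frechet_derivative_within_cong[OF that]) (rule s)
  moreover have "smooth_map (Hgrp r) (spin_section f) \<longleftrightarrow> smooth_map (Hgrp r) (spin_section g)"
    by (rule smooth_map_cong) (rule s)
  ultimately show ?thesis by (simp add: lagrangian_section_def bundle_section_def pullback2_def s)
qed

lemma lagrangian_fKminus:
  assumes r: "r \<in> {0, 1}"
  shows "lagrangian_section r (Omega r) (spin_section fKminus)"
proof -
  have "lagrangian_section r (Omega r) (spin_section adj2)"
  proof (rule lagrangian_sectionI[OF r, where f' = "\<lambda>_. adj2"])
    show "smooth_map (Hgrp r) adj2" by (rule smooth_map_linear[OF bounded_linear_adj2 smooth_map_ident])
    show "(adj2 has_derivative adj2) (at q within Hgrp r)" for q
      by (rule bounded_linear_imp_has_derivative[OF bounded_linear_adj2])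
  \<comment> \<open>Here df(q V) f(q)^-1 is \<open>- V\<close>, which is trivially
    self-adjoint.\<close>
  qed (auto simp: Hgrp_adj2 adj2_mult lie_adj2 adj2_cancel mult_simps simp flip: matrix_mul_assoc)
  then show ?thesis
    by (subst spin_section_cong[of r _ adj2]) (simp_all add: fKminus_def Hgrp_inv)
qed

lemma lagrangian_left:
  assumes r: "r \<in> {0, 1}" and g: "g \<in> lie r" and K: "K \<in> Qalg r" and det: "det g * det K = 1"
  shows "lagrangian_section r (Omega r) (spin_section (\<lambda>q. g ** adj2 q ** K))"
proof (rule lagrangian_sectionI[OF r])
  show "(\<lambda>q. g ** adj2 q ** K) \<in> Hgrp r \<rightarrow> Hgrp r"
    using g K det by (auto simp: Hgrp_iff Qalg_mult Qalg_adj2 lie_def det_mul det_adj2)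
  show "smooth_map (Hgrp r) (\<lambda>q. g ** adj2 q ** K)"
    by (intro smooth_map_bilinear[OF bounded_bilinear_mult] smooth_map_linear[OF bounded_linear_adj2]
        smooth_map_ident smooth_map_const)
  show "((\<lambda>q. g ** adj2 q ** K) has_derivative (\<lambda>v. g ** adj2 v ** K)) (at q within Hgrp r)" for q
    by (rule bounded_linear_imp_has_derivative)
      (simp add: linear_conv_bounded_linear[symmetric] linear_iff mult_simps adj2_simps)
next
  fix q V W assume q: "q \<in> Hgrp r" and V: "V \<in> lie r" and W: "W \<in> lie r"
  \<comment> \<open>\<open>adj2\<close> negates both \<open>V\<close> and \<open>g\<close>, so the
    signs cancel; \<open>q\<close> drops out, and \<open>K\<close> survives only through its
    determinant.\<close>
  have G: "g ** adj2 (q ** V) ** K ** adj2 (g ** adj2 q ** K) = mat (det K) ** (g ** V ** g)" if "V \<in> lie r" for V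
  proof -
    have "g ** adj2 (q ** V) ** K ** adj2 (g ** adj2 q ** K) = g ** V ** (adj2 q ** (K ** adj2 K) ** q) ** g"
      by (simp add: adj2_mult lie_adj2[OF g] lie_adj2[OF that] mult_simps matrix_mul_assoc)
    also have "adj2 q ** (K ** adj2 K) ** q = mat (det K) ** (adj2 q ** q)"
      by (simp only: mult_adj2(1) mat_mult_commute[of "adj2 q"] matrix_mul_assoc)
    also have "g ** V ** (mat (det K) ** (adj2 q ** q)) ** g = mat (det K) ** (g ** V ** g)"
      by (simp add: adj2_cancel(1)[OF q] mat_mult_commute[of "g ** V"] matrix_mul_assoc)
    finally show ?thesis .
  qed
  have "tr (V ** (g ** W ** g)) = tr (g ** V ** g ** W)"
    using tr_commute[of "V ** g ** W" g] by (simp add: matrix_mul_assoc)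
  then show "tr (V ** (g ** adj2 (q ** W) ** K ** adj2 (g ** adj2 q ** K)))
      = tr (g ** adj2 (q ** V) ** K ** adj2 (g ** adj2 q ** K) ** W)"
    unfolding G[OF V] G[OF W]
    by (simp add: matrix_mul_assoc mat_mult_commute[of V]) (simp add: tr_mat_mult flip: matrix_mul_assoc)
qed

lemma lagrangian_right:
  assumes r: "r \<in> {0, 1}" and g: "g \<in> lie r" and K: "K \<in> Qalg r" and det: "det g * det K = 1"
  shows "lagrangian_section r (Omega r) (spin_section (\<lambda>q. adj2 q ** g ** q ** K))"
proof (rule lagrangian_sectionI[OF r])
  show "(\<lambda>q. adj2 q ** g ** q ** K) \<in> Hgrp r \<rightarrow> Hgrp r"
    using g K det by (auto simp: Hgrp_iff Qalg_mult Qalg_adj2 lie_def det_mul det_adj2)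
  show "smooth_map (Hgrp r) (\<lambda>q. adj2 q ** g ** q ** K)"
    by (intro smooth_map_bilinear[OF bounded_bilinear_mult] smooth_map_linear[OF bounded_linear_adj2]
        smooth_map_ident smooth_map_const)
  show "((\<lambda>q. adj2 q ** g ** q ** K) has_derivative (\<lambda>v. adj2 q ** g ** v ** K + adj2 v ** g ** q ** K))
      (at q within Hgrp r)" for q
  proof (rule has_derivative_eq_rhs)
    show "((\<lambda>q. adj2 q ** g ** q ** K) has_derivative (\<lambda>v. (adj2 q ** g ** q) ** 0
        + ((adj2 q ** g) ** v + (adj2 q ** 0 + adj2 v ** g) ** q) ** K)) (at q within Hgrp r)"
      by (intro has_derivative_mult_matrix has_derivative_const has_derivative_ident
          bounded_linear_imp_has_derivative[OF bounded_linear_adj2])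
  qed (simp add: mult_simps bounded_bilinear.zero_right[OF bounded_bilinear_mult] matrix_mul_assoc)
next
  fix q V W assume q: "q \<in> Hgrp r" and V: "V \<in> lie r" and W: "W \<in> lie r"
  \<comment> \<open>The conjugate of \<open>g\<close> by \<open>q\<close> again satisfies
    \<open>adj2 k = - k\<close>. Differentiating the right factor \<open>q\<close> gives the term
    with \<open>k ** V ** k\<close>, differentiating \<open>adj2 q\<close> gives
    \<open>- V\<close>.\<close>
  define k where "k = adj2 q ** g ** q"
  have k: "adj2 k = - k"
    by (simp add: k_def adj2_mult lie_adj2[OF g] mult_simps matrix_mul_assoc)
  have "det k = det g" using Hgrp_det[OF q] by (simp add: k_def det_mul det_adj2)
  then have kK: "k ** K \<in> Hgrp r"
    using g K det q by (simp add: k_def Hgrp_iff Qalg_mult Qalg_adj2 lie_def det_mul det_adj2)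
  have G: "(adj2 q ** g ** (q ** V) ** K + adj2 (q ** V) ** g ** q ** K) ** adj2 (adj2 q ** g ** q ** K)
      = - (mat (det K) ** (k ** V ** k)) - V" if "V \<in> lie r" for V
  proof -
    have "(adj2 q ** g ** (q ** V) ** K + adj2 (q ** V) ** g ** q ** K) ** adj2 (adj2 q ** g ** q ** K)
        = k ** V ** (K ** adj2 K) ** adj2 k - V ** ((k ** K) ** adj2 (k ** K))"
      by (simp add: k_def adj2_mult lie_adj2[OF that] mult_simps matrix_mul_assoc)
    also have "\<dots> = - (mat (det K) ** (k ** V ** k)) - V"
      by (simp only: Hgrp_det[OF kK] mult_adj2(1) mat_mult_commute[of "k ** V"] k mult_simps matrix_mul_assoc
          matrix_mul_rid)
    finally show ?thesis .
  qed
  have "tr (V ** (k ** W ** k)) = tr (k ** V ** k ** W)"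
    using tr_commute[of "V ** k ** W" k] by (simp add: matrix_mul_assoc)
  moreover have "V ** (mat a ** A) = mat a ** (V ** A)" for a and A :: cmat
    by (simp add: matrix_mul_assoc mat_mult_commute[of V])
  ultimately show "tr (V ** ((adj2 q ** g ** (q ** W) ** K + adj2 (q ** W) ** g ** q ** K) ** adj2 (adj2 q ** g ** q ** K)))
      = tr ((adj2 q ** g ** (q ** V) ** K + adj2 (q ** V) ** g ** q ** K) ** adj2 (adj2 q ** g ** q ** K) ** W)"
    unfolding G[OF V] G[OF W]
    by (simp add: mult_simps tr_diff tr_uminus tr_mat_mult flip: matrix_mul_assoc)
qed

section \<open>Solving the spinor equations\<close>

text \<open>One column of an element of \<open>Qalg r\<close> determines the other, and
  \<open>spinor \<epsilon>\<close> selects a column. This is the uniqueness of the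
  solutions.\<close>

lemma Qalg_eqI:
  assumes "A \<in> Qalg r" "B \<in> Qalg r" "A *v spinor \<epsilon> = B *v spinor \<epsilon>"
  shows "A = B"
  using assms
  by (auto simp: Qalg_def cmat_eq_iff spinor_def matrix_vector_mult_def vec_eq_iff forall_2 sum_2 split: if_splits)

text \<open>The factor \<open>\<i> ^ r\<close> moves \<open>P\<close> into the real algebra.
  \<open>K\<close> undoes this scalar and exchanges the two spinors, so the product lies in the
  group and solves the equation; uniqueness is \<open>Qalg_eqI\<close>.\<close>

lemma spinor_equation_iff:
  assumes M: "mat (\<i> ^ r) ** P \<in> Qalg r" and K: "K \<in> Qalg r" and det: "det (mat (\<i> ^ r) ** P) * det K = 1"
    and K': "K *v spinor \<epsilon> = mat ((- \<i>) ^ r) *v spinor \<epsilon>'"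
  shows "h \<in> Hgrp r \<and> h *v spinor \<epsilon> = P *v spinor \<epsilon>' \<longleftrightarrow> h = mat (\<i> ^ r) ** P ** K"
proof -
  have H: "mat (\<i> ^ r) ** P ** K \<in> Hgrp r"
    using M K det by (simp add: Hgrp_iff Qalg_mult det_mul[of _ K])
  have "\<i> ^ r * (- \<i>) ^ r = 1" by (simp flip: power_mult_distrib)
  then have "mat (\<i> ^ r) ** P ** mat ((- \<i>) ^ r) = P"
    by (simp add: entries mult.assoc[symmetric] mult.commute[of _ "(- \<i>) ^ r"])
  then have "mat (\<i> ^ r) ** P ** K *v spinor \<epsilon> = P *v spinor \<epsilon>'"
    by (simp add: K' matrix_vector_mul_assoc flip: matrix_vector_mul_assoc[of _ K])
  then show ?thesis using H Qalg_eqI[OF Hgrp_Qalg Hgrp_Qalg] by metis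
qed

lemma ex_spinor_rotation:
  assumes r: "r \<in> {0, 1}" and Y: "ip r Y Y \<in> {1, - 1}" and \<epsilon>: "\<epsilon> \<in> signs r"
  shows "\<exists>K\<in>Qalg r. det K = of_real ((-1) ^ r * ip r Y Y) \<and>
    K *v spinor \<epsilon> = mat ((- \<i>) ^ r) *v spinor (eps r Y \<epsilon>)"
proof (cases "r = 0")
  case True
  \<comment> \<open>For \<open>r = 0\<close> the form is positive definite, which excludes norm -1;
    the spinor is then unchanged and the identity serves as \<open>K\<close>.\<close>
  have "ip 0 Y Y \<ge> 0" by (simp add: ip_def)
  then have "ip 0 Y Y = 1" using Y True by auto
  then show ?thesis
    using True \<epsilon> by (intro bexI[of _ "mat 1"]) (simp_all add: eps_def Qalg_mat_1)
next
  case False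
  then have r1: "r = 1" using r by simp
  \<comment> \<open>Norm 1 flips the sign of the spinor and calls for an off-diagonal
    \<open>K\<close>; norm -1 keeps it and calls for a diagonal one. One column is prescribed by the
    spinor condition, the other is forced by \<open>Qalg r\<close>.\<close>
  define K :: cmat where "K = (if ip r Y Y = 1 then vector [vector [0, \<epsilon> * \<i>], vector [- \<epsilon> * \<i>, 0]]
    else vector [vector [- \<epsilon> * \<i>, 0], vector [0, \<epsilon> * \<i>]])"
  show ?thesis
    using r1 Y \<epsilon>
    by (intro bexI[of _ K]) (auto simp: K_def signs_def eps_def spinor_def Qalg_def det_2
      matrix_vector_mult_def mat_entry vec_eq_iff forall_2 sum_2)
qed

lemma Clifford_lie:
  assumes r: "r \<in> {0, 1}"
  shows "mat (\<i> ^ r) ** gam r Y \<in> lie r"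
proof -
  have "mat (\<i> ^ r) ** gam r Y = 2 *\<^sub>R lg r Y"
    by (simp add: cmat_eq_iff lg_entry mult_entry mat_entry scaleR_conv_of_real[where 'a = complex])
  then show ?thesis by (simp only: lie_scaleR lg_lie[OF r])
qed

lemma det_Clifford:
  assumes r: "r \<in> {0, 1}"
  shows "det (mat (\<i> ^ r) ** gam r Y) = of_real ((-1) ^ r * ip r Y Y)"
  using r by (auto simp: det_2 mult_entry mat_entry gam_entry ip_def complex_eq_iff algebra_simps)

theorem corollary3p5:
  fixes r :: nat and f :: "cmat \<Rightarrow> cmat"
  assumes r: "r \<in> {0, 1}"
    and f: "f = fKplus \<or> f = fKminus \<or>
      (\<exists>Y \<epsilon>. ip r Y Y \<in> {1, - 1} \<and> \<epsilon> \<in> signs r \<and> (f = fR r Y \<epsilon> \<or> f = fL r Y \<epsilon>))"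
  shows
    "(\<forall>Y \<epsilon>. ip r Y Y \<in> {1, - 1} \<longrightarrow> \<epsilon> \<in> signs r \<longrightarrow>
        (\<forall>q\<in>Hgrp r. (\<exists>!h. h \<in> Hgrp r \<and> fR_eq r Y \<epsilon> q h) \<and> (\<exists>!h. h \<in> Hgrp r \<and> fL_eq r Y \<epsilon> q h))) \<and>
     f \<in> Hgrp r \<rightarrow> Hgrp r \<and>
     lagrangian_section r (Omega r) (spin_section f) \<and>
     nearly_pseudo_kaehler (spin_bundle r) (Gc r (sqrt 3)) (Jc r (sqrt 3)) \<and>
     lagrangian_section r (\<lambda>p v w. Gc r (sqrt 3) p (Jc r (sqrt 3) p v) w) (spin_section f)"
proof -
  \<comment> \<open>One pair \<open>g\<close>, \<open>K\<close> gives closed forms for the solutions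
    of both spinor equations at every \<open>q\<close>.\<close>
  have solve: "\<exists>g\<in>lie r. \<exists>K\<in>Qalg r. det g * det K = 1 \<and> (\<forall>q\<in>Hgrp r.
      (\<forall>h. h \<in> Hgrp r \<and> fR_eq r Y \<epsilon> q h \<longleftrightarrow> h = adj2 q ** g ** q ** K) \<and>
      (\<forall>h. h \<in> Hgrp r \<and> fL_eq r Y \<epsilon> q h \<longleftrightarrow> h = g ** adj2 q ** K))"
    if Y: "ip r Y Y \<in> {1, - 1}" and \<epsilon>: "\<epsilon> \<in> signs r" for Y \<epsilon>
  proof -
    define g where "g = mat (\<i> ^ r) ** gam r Y"
    have g: "g \<in> lie r" "det g = of_real ((-1) ^ r * ip r Y Y)"
      unfolding g_def by (rule Clifford_lie[OF r], rule det_Clifford[OF r])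
    obtain K where K: "K \<in> Qalg r" "det K = of_real ((-1) ^ r * ip r Y Y)"
        "K *v spinor \<epsilon> = mat ((- \<i>) ^ r) *v spinor (eps r Y \<epsilon>)"
      using ex_spinor_rotation[OF r Y \<epsilon>] by blast
    \<comment> \<open>\<open>g\<close> and \<open>K\<close> have the same determinant, a sign, so
      the product of the two determinants is 1.\<close>
    have "((-1) ^ r * ip r Y Y) * ((-1) ^ r * ip r Y Y) = 1" using Y by auto
    then have det: "det g * det K = 1" unfolding g(2) K(2) by (metis of_real_1 of_real_mult)
    have "h \<in> Hgrp r \<and> fR_eq r Y \<epsilon> q h \<longleftrightarrow> h = adj2 q ** g ** q ** K"
      and "h \<in> Hgrp r \<and> fL_eq r Y \<epsilon> q h \<longleftrightarrow> h = g ** adj2 q ** K" if q: "q \<in> Hgrp r" for q h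
    proof -
      have R: "mat (\<i> ^ r) ** (adj2 q ** gam r Y ** q) = adj2 q ** g ** q"
        and L: "mat (\<i> ^ r) ** (gam r Y ** adj2 q) = g ** adj2 q"
        by (simp_all add: g_def matrix_mul_assoc mat_mult_commute[of "adj2 q"])
      have "adj2 q ** g ** q \<in> Qalg r" "g ** adj2 q \<in> Qalg r"
        "det (adj2 q ** g ** q) * det K = 1" "det (g ** adj2 q) * det K = 1"
        using q g(1) det by (simp_all add: Hgrp_iff lie_def Qalg_mult Qalg_adj2 det_mul det_adj2)
      then show "h \<in> Hgrp r \<and> fR_eq r Y \<epsilon> q h \<longleftrightarrow> h = adj2 q ** g ** q ** K"
        and "h \<in> Hgrp r \<and> fL_eq r Y \<epsilon> q h \<longleftrightarrow> h = g ** adj2 q ** K"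
        unfolding fR_eq_def fL_eq_def Hgrp_inv[OF q]
        using spinor_equation_iff[of r "adj2 q ** gam r Y ** q" K \<epsilon> "eps r Y \<epsilon>" h]
          spinor_equation_iff[of r "gam r Y ** adj2 q" K \<epsilon> "eps r Y \<epsilon>" h] K(1,3)
        unfolding R L by blast+
    qed
    then show ?thesis using g(1) K(1) det by blast
  qed
  have "(\<exists>!h. h \<in> Hgrp r \<and> fR_eq r Y \<epsilon> q h) \<and> (\<exists>!h. h \<in> Hgrp r \<and> fL_eq r Y \<epsilon> q h)"
    if Y: "ip r Y Y \<in> {1, - 1}" "\<epsilon> \<in> signs r" and q: "q \<in> Hgrp r" for Y \<epsilon> q
  proof -
    obtain g K where "\<And>h. h \<in> Hgrp r \<and> fR_eq r Y \<epsilon> q h \<longleftrightarrow> h = adj2 q ** g ** q ** K"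
      "\<And>h. h \<in> Hgrp r \<and> fL_eq r Y \<epsilon> q h \<longleftrightarrow> h = g ** adj2 q ** K"
      using solve[OF Y] q by blast
    then show ?thesis by simp
  qed
  moreover have L: "lagrangian_section r (Omega r) (spin_section f)"
    using f
  proof (elim disjE exE conjE)
    fix Y \<epsilon> assume Y: "ip r Y Y \<in> {1, - 1}" "\<epsilon> \<in> signs r"
    obtain g K where gK: "g \<in> lie r" "K \<in> Qalg r" "det g * det K = 1"
      and R: "\<And>q h. q \<in> Hgrp r \<Longrightarrow> h \<in> Hgrp r \<and> fR_eq r Y \<epsilon> q h \<longleftrightarrow> h = adj2 q ** g ** q ** K"
      and L: "\<And>q h. q \<in> Hgrp r \<Longrightarrow> h \<in> Hgrp r \<and> fL_eq r Y \<epsilon> q h \<longleftrightarrow> h = g ** adj2 q ** K"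
      using solve[OF Y] by blast
    show "lagrangian_section r (Omega r) (spin_section f)" if "f = fR r Y \<epsilon>"
      using lagrangian_right[OF r gK]
      by (subst spin_section_cong[of r f]) (simp_all add: that fR_def R)
    show "lagrangian_section r (Omega r) (spin_section f)" if "f = fL r Y \<epsilon>"
      using lagrangian_left[OF r gK]
      by (subst spin_section_cong[of r f]) (simp_all add: that fL_def L)
  qed (simp_all only: lagrangian_fKplus[OF r] lagrangian_fKminus[OF r])
  \<comment> \<open>Recovered from the section: its first component \<open>q ** f q\<close> lies in
    the group, and so does \<open>q\<close>.\<close>
  moreover have H: "f \<in> Hgrp r \<rightarrow> Hgrp r"
  proof
    fix q assume q: "q \<in> Hgrp r"
    then have "q ** f q \<in> Hgrp r"
      using L by (auto simp: lagrangian_section_def bundle_section_def spin_bundle_def spin_section_def)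
    from Hgrp_mult[OF Hgrp_adj2[OF q] this] show "f q \<in> Hgrp r" by (simp add: adj2_cancel[OF q])
  qed
  moreover note nearly_pseudo_kaehler_spin_bundle[OF r]
  ultimately show ?thesis using lagrangian_section_Gc_Jc[OF r H _ L, of "sqrt 3"] by simp
qed

end
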